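(* Let $k\ge 2$ be a fixed integer, let $r>-1$ be a real number, and let $f\in \mathcal{A}_r$. Then for every $\varepsilon>0$, as $x\to\infty$, $$\sum_{n_1,\ldots,n_k\le x} f([n_1,\ldots,n_k]) = C_{f,k}\,\frac{x^{k(r+1)}}{(r+1)^k}+O\left(x^{k(r+1)-\frac12\min(r+1,1)+\varepsilon}\right),$$ and $$\sum_{n_1,\ldots,n_k\le x} \frac{f([n_1,\ldots,n_k])}{(n_1\cdots n_k)^r} = C_{f,k}\,x^k+O\left(x^{k-\frac12\min(r+1,1)+\varepsilon}\right),$$ where $$C_{f,k}=\prod_p\left(1-\frac1p\right)^k\sum_{\nu_1,\ldots,\nu_k=0}^{\infty}\frac{f(p^{\max(\nu_1,\ldots,\nu_k)})}{p^{(r+1)(\nu_1+\cdots+\nu_k)}},$$ the product being over all primes $p$.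
   Context: $[n_1,\ldots,n_k]$ denotes the least common multiple of the positive integers $n_1,\ldots,n_k$; sums over $n_1,\ldots,n_k\le x$ run over all $k$-tuples of positive integers each at most $x$. Implied constants may depend on $f$, $k$, $r$, $\varepsilon$. For $r\in\mathbb{R}$, $\mathcal{A}_r$ denotes the class of complex valued multiplicative arithmetic functions $f$ for which there exist real constants $C_1,C_2$ such that (i) $|f(p)-p^r|\le C_1p^{r-1/2}$ for every prime $p$, and (ii) $|f(p^\nu)|\le C_2p^{\nu r}$ for every prime power $p^\nu$ with $\nu\ge 2$. *)

theory Defs
  imports
    "HOL-Analysis.Analysis"
    "HOL-Library.Landau_Symbols"
    "HOL-Library.FuncSet"
    "HOL-Computational_Algebra.Primes"
begin

text \<open>
  Arithmetic functions are functions on the positive integers; the value at \<open>0\<close> is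
  unconstrained and never used.
\<close>
definition multiplicative_arith :: "(nat \<Rightarrow> complex) \<Rightarrow> bool" where
  "multiplicative_arith f \<longleftrightarrow>
     f 1 = 1 \<and> (\<forall>m>0. \<forall>n>0. coprime m n \<longrightarrow> f (m * n) = f m * f n)"

definition class_A :: "real \<Rightarrow> (nat \<Rightarrow> complex) set" where
  "class_A r = {f. multiplicative_arith f \<and>
     (\<exists>C1 C2 :: real.
        (\<forall>p. prime p \<longrightarrow>
           norm (f p - of_real (real p powr r)) \<le> C1 * real p powr (r - 1/2)) \<and>
        (\<forall>p \<nu>. prime p \<and> \<nu> \<ge> 2 \<longrightarrow> norm (f (p ^ \<nu>)) \<le> C2 * real p powr (real \<nu> * r)))}"

text \<open>
  A \<open>k\<close>-tuple is an extensional function on \<open>{1..k}\<close>, so that distinct functions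
  represent distinct tuples.
\<close>
definition pos_tuples_upto :: "nat \<Rightarrow> real \<Rightarrow> (nat \<Rightarrow> nat) set" where
  "pos_tuples_upto k x = {1..k} \<rightarrow>\<^sub>E {n. n \<ge> 1 \<and> real n \<le> x}"

definition exponent_tuples :: "nat \<Rightarrow> (nat \<Rightarrow> nat) set" where
  "exponent_tuples k = {1..k} \<rightarrow>\<^sub>E UNIV"

definition tuple_lcm :: "nat \<Rightarrow> (nat \<Rightarrow> nat) \<Rightarrow> nat" where
  "tuple_lcm k n = Lcm (n ` {1..k})"

definition local_term :: "real \<Rightarrow> (nat \<Rightarrow> complex) \<Rightarrow> nat \<Rightarrow> nat \<Rightarrow> (nat \<Rightarrow> nat) \<Rightarrow> complex" where
  "local_term r f k p \<nu> =
     f (p ^ Max (\<nu> ` {1..k})) / of_real (real p powr ((r + 1) * real (\<Sum>i=1..k. \<nu> i)))"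

text \<open>The product over primes is indexed by all natural numbers, with factor \<open>1\<close> at non-primes.\<close>
definition euler_factor :: "real \<Rightarrow> (nat \<Rightarrow> complex) \<Rightarrow> nat \<Rightarrow> nat \<Rightarrow> complex" where
  "euler_factor r f k p =
     (if prime p
      then (1 - 1 / of_nat p) ^ k * (\<Sum>\<^sub>\<infinity>\<nu>\<in>exponent_tuples k. local_term r f k p \<nu>)
      else 1)"

definition lcm_const :: "real \<Rightarrow> (nat \<Rightarrow> complex) \<Rightarrow> nat \<Rightarrow> complex" where
  "lcm_const r f k = prodinf (euler_factor r f k)"

end

theory Submission
  imports Defs
begin

text \<open>
  Write \<open>f [n\<^sub>1,\<dots>,n\<^sub>k]\<close> as the convolution of \<open>(n\<^sub>1 \<dots> n\<^sub>k) powr r\<close> with a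
  multiplicative function \<open>h\<close> of \<open>k\<close> variables. The hypotheses on \<open>f\<close> make the first order terms of
  the local series of \<open>h\<close> cancel up to \<open>O(p powr (-3/2))\<close>, so that
  \<open>\<Sum>\<^sub>e |h e| (e\<^sub>1 \<dots> e\<^sub>k) powr (-r-1) * e\<^sub>i powr b\<close> converges for every \<open>i\<close> and every
  \<open>0 \<le> b < min (r+1) 1 / 2\<close>, and the sum of \<open>h e (e\<^sub>1 \<dots> e\<^sub>k) powr (-r-1)\<close> is the Euler product.
  The error in \<open>\<Sum>d\<le>y. d powr (s-1) = y powr s / s + O(y powr (s-b))\<close> is valid for all \<open>y > 0\<close>, also
  for \<open>y < 1\<close>; hence the sum over \<open>e\<close> can be extended to all tuples without truncation, and the total
  error is \<open>O(x powr (k s - b))\<close> with \<open>s = r + 1\<close> for the first sum and \<open>s = 1\<close> for the second.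
\<close>

text \<open>The maximum in \<open>f (p ^ Max ...)\<close> couples the k variables, so the local
  series does not split. Multiplying it by the k factors \<open>1 - p powr r * z\<close> removes the
  part that it shares with the local series of \<open>(n_1 ... n_k) powr r\<close>. With c = min
  (r+1) 1 / 2, three kinds of terms remain after weighting: the coefficient
  \<open>f p - p powr r\<close> at a unit vector, with exponent of 1/p equal to 3/2 - b; products of
  total order at least two, with exponent 2 - 2b or more; and tuples in which several entries share
  one prime to the first power, with exponent 1 - b + (r+1) or more. All three are at least 1 + (c -
  b), so for b < c the sum over primes converges. For r \<ge> 0, b = 1/2 would put the first kind on
  the divergent exponent 1; this is what the epsilon of the theorem pays for. Telescoping a product
  of k power sums charges the saving b to a single coordinate in each summand. Hence b multiplies
  one entry of the exponent tuple in the estimates and not the sum of the entries.\<close>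

section \<open>Sums of powers\<close>

text \<open>The endpoint u = 0 is allowed because one induction below starts with the step from 0 to
  1. Continuity is used up to the endpoint, the derivative only in the interior.\<close>

lemma powr_diff_MVT:
  fixes s u v :: real
  assumes "s > 0" "0 \<le> u" "u < v"
  obtains \<xi> where "u < \<xi>" "\<xi> < v" "v powr s - u powr s = (v - u) * (s * \<xi> powr (s - 1))"
proof -
  have "continuous_on {u..v} (\<lambda>x. x powr s)"
    using assms by (intro continuous_on_powr' continuous_intros) auto
  moreover have "((\<lambda>x. x powr s) has_real_derivative s * x powr (s - 1)) (at x)" if "u < x" for x
    using assms that by (intro has_real_derivative_powr) auto
  ultimately obtain l \<xi> where \<xi>: "u < \<xi>" "\<xi> < v"
      "((\<lambda>x. x powr s) has_real_derivative l) (at \<xi>)" "v powr s - u powr s = (v - u) * l"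
    using MVT[OF assms(3), of "\<lambda>x. x powr s"] by (metis real_differentiable_def)
  have "l = s * \<xi> powr (s - 1)"
    using DERIV_unique \<xi>(1,3) assms(2) has_real_derivative_powr[of \<xi> s] by auto
  thus ?thesis using that \<xi> by blast
qed

text \<open>Indexed by the exponent of the main term \<open>y powr s / s\<close>; the summands have
  exponent s - 1.\<close>

definition power_sum :: "real \<Rightarrow> real \<Rightarrow> real" where
  "power_sum s y = (\<Sum>d | 1 \<le> d \<and> real d \<le> y. real d powr (s - 1))"

lemma nat_upto_real_eq: "{d. 1 \<le> d \<and> real d \<le> y} = {1..nat \<lfloor>y\<rfloor>}"
  by (auto simp: le_nat_floor) linarith+

text \<open>From N to N + 1 the difference changes by
  \<open>(N+1) powr (s-1) - \<xi> powr (s-1)\<close> with \<xi> between N and N + 1. For s \<ge> 1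
  this lies between 0 and \<open>(N+1) powr (s-1) - N powr (s-1)\<close>, and these upper bounds
  telescope.\<close>

lemma power_sum_nat_error_ge_1:
  assumes "s \<ge> 1"
  shows "(\<Sum>d=1..N. real d powr (s - 1)) - real N powr s / s \<in> {0..real N powr (s - 1)}"
proof (induction N)
  case (Suc N)
  obtain \<xi> where \<xi>: "real N < \<xi>" "\<xi> < real (Suc N)"
      "real (Suc N) powr s - real N powr s = (real (Suc N) - real N) * (s * \<xi> powr (s - 1))"
    using powr_diff_MVT[of s "real N" "real (Suc N)"] assms by auto
  have "real N powr (s - 1) \<le> \<xi> powr (s - 1)" "\<xi> powr (s - 1) \<le> real (Suc N) powr (s - 1)"
    using \<xi> assms by (auto intro!: powr_mono2)
  moreover have "real (Suc N) powr s / s = real N powr s / s + \<xi> powr (s - 1)"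
    using \<xi>(3) assms by (simp add: field_simps)
  ultimately show ?case using Suc.IH by auto
qed auto

text \<open>For s < 1 the summands decrease, so the roles of sum and integral are exchanged. The
  telescoping starts at N = 1 with the value 1/s - 1, and the error stays bounded.\<close>

lemma power_sum_nat_error_lt_1:
  assumes "0 < s" "s < 1" "N \<ge> 1"
  shows "real N powr s / s - (\<Sum>d=1..N. real d powr (s - 1)) \<in> {0..1/s - real N powr (s - 1)}"
  using assms(3)
proof (induction N rule: dec_induct)
  case base
  show ?case using assms by auto
next
  case (step N)
  obtain \<xi> where \<xi>: "real N < \<xi>" "\<xi> < real (Suc N)"
      "real (Suc N) powr s - real N powr s = (real (Suc N) - real N) * (s * \<xi> powr (s - 1))"
    using powr_diff_MVT[of s "real N" "real (Suc N)"] assms by auto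
  have "real N powr (s - 1) \<ge> \<xi> powr (s - 1)" "\<xi> powr (s - 1) \<ge> real (Suc N) powr (s - 1)"
    using \<xi> assms step by (auto intro!: powr_mono2')
  moreover have "real (Suc N) powr s / s = real N powr s / s + \<xi> powr (s - 1)"
    using \<xi>(3) assms by (simp add: field_simps)
  ultimately show ?case using step.IH by auto
qed

text \<open>For y \<ge> 1 the error is O(y powr (s-1)) if s \<ge> 1 and O(1) if s < 1, in both cases
  O(y powr (s - min s 1)), and a smaller b only weakens this. For y < 1 the sum is empty, and the
  main term itself is at most \<open>y powr (s - b) / s\<close> because b \<ge> 0.\<close>

lemma power_sum_error:
  assumes "0 < s" "0 \<le> b" "b \<le> min s 1" "y > 0"
  shows "\<bar>power_sum s y - y powr s / s\<bar> \<le> (2 + 1 / s) * y powr (s - b)"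
proof (cases "y \<ge> 1")
  case False
  hence "{d. 1 \<le> d \<and> real d \<le> y} = {}" by auto
  hence "\<bar>power_sum s y - y powr s / s\<bar> = (1 / s) * y powr s"
    using assms by (simp only: power_sum_def) simp
  also have "\<dots> \<le> (2 + 1 / s) * y powr (s - b)"
    using assms False by (intro mult_mono powr_mono') auto
  finally show ?thesis .
next
  case True
  define N where "N = nat \<lfloor>y\<rfloor>"
  have N: "N \<ge> 1" "real N \<le> y"
    using True by (auto simp: N_def le_nat_floor)
  have S: "power_sum s y = (\<Sum>d=1..N. real d powr (s - 1))"
    unfolding power_sum_def nat_upto_real_eq N_def ..
  \<comment> \<open>Passage from the integer N to y: by the mean value theorem the main term grows
    by at most one value of the integrand, since y - N \<le> 1.\<close>
  have y: "0 \<le> y powr s / s - real N powr s / s \<and>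
           y powr s / s - real N powr s / s \<le> (if s \<ge> 1 then y powr (s - 1) else 1)"
  proof (cases "real N = y")
    case False
    then obtain \<xi> where \<xi>: "real N < \<xi>" "\<xi> < y"
        "y powr s - real N powr s = (y - real N) * (s * \<xi> powr (s - 1))"
      using powr_diff_MVT[of s "real N" y] assms N by auto
    have eq: "y powr s / s - real N powr s / s = (y - real N) * \<xi> powr (s - 1)"
      using \<xi>(3) assms by (simp add: field_simps)
    have "\<xi> powr (s - 1) \<le> (if s \<ge> 1 then y powr (s - 1) else 1)"
      using \<xi> N powr_mono2[of "s-1" \<xi> y] powr_mono2'[of "s-1" 1 \<xi>] by auto
    moreover have "y - real N \<le> 1" unfolding N_def using True by linarith
    ultimately have "(y - real N) * \<xi> powr (s - 1) \<le> 1 * (if s \<ge> 1 then y powr (s - 1) else 1)"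
      using N by (intro mult_mono) auto
    thus ?thesis unfolding eq using N by auto
  qed (auto simp: assms)
  have "\<bar>power_sum s y - y powr s / s\<bar> \<le> (2 + 1 / s) * y powr (s - min s 1)"
  proof (cases "s \<ge> 1")
    case True
    have "real N powr (s - 1) \<le> y powr (s - 1)" using N True by (intro powr_mono2) auto
    hence "\<bar>power_sum s y - y powr s / s\<bar> \<le> 2 * y powr (s - 1)"
      using power_sum_nat_error_ge_1[OF True, of N] y True unfolding S by auto
    also have "\<dots> \<le> (2 + 1 / s) * y powr (s - 1)"
      using assms by (intro mult_right_mono) auto
    finally show ?thesis using True by simp
  next
    case False
    have "real N powr (s - 1) \<ge> 0" by simp
    hence "\<bar>power_sum s y - y powr s / s\<bar> \<le> 1 + 1 / s"
      using power_sum_nat_error_lt_1[of s N] assms N y False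
      unfolding S atLeastAtMost_iff by (smt (verit) divide_pos_pos)
    thus ?thesis using False assms by simp
  qed
  also have "\<dots> \<le> (2 + 1 / s) * y powr (s - b)"
    using assms True by (intro mult_left_mono powr_mono) auto
  finally show ?thesis .
qed

lemma power_sum_nonneg: "power_sum s y \<ge> 0"
  unfolding power_sum_def by (intro sum_nonneg) auto

text \<open>Dividing every factor by \<open>A * y i powr s\<close> brings power sums and main terms
  into [0, 1]. There the difference of two products is at most the sum of the differences of the
  factors, so each summand carries \<open>y i powr (-b)\<close> for one i only.\<close>

lemma prod_power_sum_error:
  fixes y :: "'i \<Rightarrow> real"
  assumes "0 < s" "0 \<le> b" "b \<le> min s 1"
  obtains K where "K \<ge> 0" "\<And>y::'i \<Rightarrow> real. (\<And>i. i \<in> I \<Longrightarrow> y i > 0) \<Longrightarrow>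
    \<bar>(\<Prod>i\<in>I. power_sum s (y i)) - (\<Prod>i\<in>I. y i powr s / s)\<bar>
      \<le> K * (\<Sum>i\<in>I. (\<Prod>j\<in>I. y j powr s) * y i powr (-b))"
proof
  \<comment> \<open>The power sum is at most its main term plus its error with b = 0, that is
    \<open>(1/s + 2 + 1/s) * y powr s\<close>; this A also dominates 1/s and the error constant 2 +
    1/s.\<close>
  define A where "A = 2 + 2 / s"
  have A: "A > 0" "2 + 1/s \<le> A" "1/s \<le> A" using assms by (auto simp: A_def field_simps)
  show "A ^ card I \<ge> 0" using A by simp
  fix y :: "'i \<Rightarrow> real" assume y: "\<And>i. i \<in> I \<Longrightarrow> y i > 0"
  define z where "z = (\<lambda>i. power_sum s (y i) / (A * y i powr s))"
  define w where "w = (\<lambda>i. (y i powr s / s) / (A * y i powr s))"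
  have z: "norm (z i) \<le> 1" if "i \<in> I" for i
  proof -
    have "power_sum s (y i) \<le> y i powr s / s + (2 + 1 / s) * y i powr (s - 0)"
      using power_sum_error[of s 0 "y i"] assms y that by auto
    also have "\<dots> = A * y i powr s" by (simp add: A_def field_simps)
    finally show ?thesis
      using A y[OF that] power_sum_nonneg[of s "y i"] unfolding z_def by (auto simp: abs_mult)
  qed
  have w: "norm (w i) \<le> 1" if "i \<in> I" for i
    using A y[OF that] assms unfolding w_def by (auto simp: abs_mult field_simps)
  have dzw: "norm (z i - w i) \<le> y i powr (-b)" if "i \<in> I" for i
  proof -
    have "norm (z i - w i) = \<bar>(power_sum s (y i) - y i powr s / s) / (A * y i powr s)\<bar>"
      unfolding z_def w_def real_norm_def diff_divide_distrib ..
    also have "\<dots> = \<bar>power_sum s (y i) - y i powr s / s\<bar> / (A * y i powr s)"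
      using A by (simp add: abs_mult)
    also have "\<dots> \<le> ((2 + 1 / s) * y i powr (s - b)) / (A * y i powr s)"
      using power_sum_error[of s b "y i"] assms y that A by (intro divide_right_mono) auto
    also have "\<dots> \<le> (A * y i powr (s - b)) / (A * y i powr s)"
      using A by (intro divide_right_mono mult_right_mono) auto
    also have "\<dots> = y i powr (-b)"
      using A y[OF that] by (simp add: powr_diff powr_minus field_simps)
    finally show ?thesis .
  qed
  have scale: "(\<Prod>i\<in>I. g i) = A ^ card I * (\<Prod>i\<in>I. y i powr s) * (\<Prod>i\<in>I. g i / (A * y i powr s))" for g
  proof -
    have "(\<Prod>i\<in>I. g i) = (\<Prod>i\<in>I. (A * y i powr s) * (g i / (A * y i powr s)))"
      using A y by (intro prod.cong) force+
    thus ?thesis by (simp only: prod.distrib prod_constant)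
  qed
  have "\<bar>(\<Prod>i\<in>I. power_sum s (y i)) - (\<Prod>i\<in>I. y i powr s / s)\<bar>
        = \<bar>A ^ card I * (\<Prod>i\<in>I. y i powr s) * (prod z I - prod w I)\<bar>"
    by (subst (1 2) scale) (simp add: z_def w_def right_diff_distrib)
  also have "\<dots> = A ^ card I * (\<Prod>i\<in>I. y i powr s) * norm (prod z I - prod w I)"
    using A by (simp add: abs_mult prod_nonneg)
  also have "\<dots> \<le> A ^ card I * (\<Prod>i\<in>I. y i powr s) * (\<Sum>i\<in>I. norm (z i - w i))"
    using norm_prod_diff[of I z w] z w A by (intro mult_left_mono mult_nonneg_nonneg prod_nonneg) auto
  also have "\<dots> \<le> A ^ card I * (\<Prod>i\<in>I. y i powr s) * (\<Sum>i\<in>I. y i powr (-b))"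
    using dzw A by (intro mult_left_mono sum_mono mult_nonneg_nonneg prod_nonneg) auto
  also have "\<dots> = A ^ card I * (\<Sum>i\<in>I. (\<Prod>j\<in>I. y j powr s) * y i powr (-b))"
    by (simp add: sum_distrib_left mult.assoc)
  finally show "\<bar>(\<Prod>i\<in>I. power_sum s (y i)) - (\<Prod>i\<in>I. y i powr s / s)\<bar>
      \<le> A ^ card I * (\<Sum>i\<in>I. (\<Prod>j\<in>I. y j powr s) * y i powr (-b))" .
qed

section \<open>Sums of convolutions over tuples\<close>

definition pos_tuples :: "nat \<Rightarrow> (nat \<Rightarrow> nat) set" where
  "pos_tuples k = {1..k} \<rightarrow>\<^sub>E {1..}"

definition tuple_dvd :: "nat \<Rightarrow> (nat \<Rightarrow> nat) \<Rightarrow> (nat \<Rightarrow> nat) \<Rightarrow> bool" where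
  "tuple_dvd k e n \<longleftrightarrow> (\<forall>i\<in>{1..k}. e i dvd n i)"

lemma finite_pos_tuples_upto: "finite (pos_tuples_upto k x)"
proof -
  have "{n. n \<ge> 1 \<and> real n \<le> x} = {1..nat \<lfloor>x\<rfloor>}" by (rule nat_upto_real_eq)
  thus ?thesis unfolding pos_tuples_upto_def by (intro finite_PiE) auto
qed

lemma pos_tuples_upto_subset: "pos_tuples_upto k x \<subseteq> pos_tuples k"
  unfolding pos_tuples_upto_def pos_tuples_def by (intro PiE_mono) auto

lemma pos_tuplesD: "e \<in> pos_tuples k \<Longrightarrow> i \<in> {1..k} \<Longrightarrow> e i > 0"
  unfolding pos_tuples_def by (force simp: PiE_iff)

lemma pos_tuples_upto_dvd:
  assumes "n \<in> pos_tuples_upto k x" "e \<in> pos_tuples k" "tuple_dvd k e n"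
  shows "e \<in> pos_tuples_upto k x"
proof -
  have "e i \<le> n i" if "i \<in> {1..k}" for i
    using assms that by (auto simp: pos_tuples_upto_def tuple_dvd_def PiE_iff Suc_le_eq intro!: dvd_imp_le)
  thus ?thesis using assms unfolding pos_tuples_upto_def pos_tuples_def PiE_iff
    by (force intro: order_trans[of "real (e _)" "real (n _)"])
qed

lemma sum_multiples_powr:
  assumes "e > 0"
  shows "(\<Sum>n | 1 \<le> n \<and> real n \<le> x \<and> e dvd n. (real n / real e) powr t) = power_sum (t + 1) (x / real e)"
proof -
  have "(\<Sum>n | 1 \<le> n \<and> real n \<le> x \<and> e dvd n. (real n / real e) powr t)
        = (\<Sum>d | 1 \<le> d \<and> real d \<le> x / real e. real d powr t)"
    using assms by (intro sum.reindex_bij_witness[of _ "\<lambda>d. e * d" "\<lambda>n. n div e"])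
      (auto simp: field_simps elim!: dvdE)
  thus ?thesis by (simp add: power_sum_def)
qed

lemma sum_multiple_tuples_powr:
  assumes e: "e \<in> pos_tuples k"
  shows "(\<Sum>n | n \<in> pos_tuples_upto k x \<and> tuple_dvd k e n. \<Prod>i=1..k. (real (n i) / real (e i)) powr t)
         = (\<Prod>i=1..k. power_sum (t + 1) (x / real (e i)))"
proof -
  have "{n. n \<in> pos_tuples_upto k x \<and> tuple_dvd k e n}
        = PiE {1..k} (\<lambda>i. {n. 1 \<le> n \<and> real n \<le> x \<and> e i dvd n})"
    unfolding pos_tuples_upto_def tuple_dvd_def by (auto simp: PiE_iff extensional_def)
  hence "(\<Sum>n | n \<in> pos_tuples_upto k x \<and> tuple_dvd k e n. \<Prod>i=1..k. (real (n i) / real (e i)) powr t)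
       = (\<Prod>i=1..k. \<Sum>n | 1 \<le> n \<and> real n \<le> x \<and> e i dvd n. (real n / real (e i)) powr t)"
    by (subst prod_sum_PiE) (auto intro: finite_subset[OF _ finite_atLeastAtMost[of 1 "nat \<lfloor>x\<rfloor>"]] simp: le_nat_floor)
  also have "\<dots> = (\<Prod>i=1..k. power_sum (t + 1) (x / real (e i)))"
    using pos_tuplesD[OF e] by (intro prod.cong sum_multiples_powr) auto
  finally show ?thesis .
qed

text \<open>The parameter q treats both sums of the theorem at once, with q = 0 and q = r. Since
  \<open>(n/e) powr r / n powr q = e powr (-q) * (n/e) powr (r-q)\<close>, exchanging the summations
  leaves for each e a sum over multiples that factors into one-variable power sums.\<close>

lemma sum_convolution_tuples:
  fixes F h :: "(nat \<Rightarrow> nat) \<Rightarrow> complex"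
  assumes F: "\<And>n. n \<in> pos_tuples k \<Longrightarrow> F n =
      (\<Sum>e | e \<in> pos_tuples k \<and> tuple_dvd k e n. h e * (\<Prod>i=1..k. of_real ((real (n i) / real (e i)) powr r)))"
  shows "(\<Sum>n\<in>pos_tuples_upto k x. F n / of_real (real (\<Prod>i=1..k. n i) powr q))
       = (\<Sum>e\<in>pos_tuples_upto k x. h e * of_real (\<Prod>i=1..k. real (e i) powr (-q))
            * of_real (\<Prod>i=1..k. power_sum (r - q + 1) (x / real (e i))))"
proof -
  define X where "X = pos_tuples_upto k x"
  have X: "finite X" "X \<subseteq> pos_tuples k"
    unfolding X_def by (rule finite_pos_tuples_upto pos_tuples_upto_subset)+
  have Fn: "F n / of_real (real (\<Prod>i=1..k. n i) powr q)
      = (\<Sum>e | e \<in> X \<and> tuple_dvd k e n. h e * of_real (\<Prod>i=1..k. real (e i) powr (-q))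
          * of_real (\<Prod>i=1..k. (real (n i) / real (e i)) powr (r - q)))" if n: "n \<in> X" for n
  proof -
    have "F n / of_real (real (\<Prod>i=1..k. n i) powr q)
       = (\<Sum>e | e \<in> X \<and> tuple_dvd k e n. h e * of_real ((\<Prod>i=1..k. (real (n i) / real (e i)) powr r)
            / (real (\<Prod>i=1..k. n i) powr q)))"
      using n X pos_tuples_upto_dvd[of n k x]
      by (subst F) (auto simp: sum_divide_distrib X_def intro!: sum.cong)
    also have "\<dots> = (\<Sum>e | e \<in> X \<and> tuple_dvd k e n. h e * of_real ((\<Prod>i=1..k. real (e i) powr (-q))
          * (\<Prod>i=1..k. (real (n i) / real (e i)) powr (r - q))))"
    proof (intro sum.cong refl arg_cong2[of _ _ _ _ "(*)"] arg_cong[of _ _ of_real])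
      fix e assume e: "e \<in> {e. e \<in> X \<and> tuple_dvd k e n}"
      have "(\<Prod>i=1..k. (real (n i) / real (e i)) powr r) / (real (\<Prod>i=1..k. n i) powr q)
          = (\<Prod>i=1..k. (real (n i) / real (e i)) powr r / real (n i) powr q)"
        by (simp add: prod_powr_distrib prod_dividef)
      also have "\<dots> = (\<Prod>i=1..k. real (e i) powr (-q) * (real (n i) / real (e i)) powr (r - q))"
      proof (intro prod.cong refl)
        fix i assume "i \<in> {1..k}"
        hence "e i > 0" "n i > 0" using e n X pos_tuplesD by blast+
        thus "(real (n i) / real (e i)) powr r / real (n i) powr q
            = real (e i) powr (-q) * (real (n i) / real (e i)) powr (r - q)"
          by (simp add: powr_divide powr_diff powr_minus field_simps)
      qed
      finally show "(\<Prod>i=1..k. (real (n i) / real (e i)) powr r) / (real (\<Prod>i=1..k. n i) powr q)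
          = (\<Prod>i=1..k. real (e i) powr (-q)) * (\<Prod>i=1..k. (real (n i) / real (e i)) powr (r - q))"
        by (simp add: prod.distrib)
    qed
    finally show ?thesis by (simp add: mult.assoc)
  qed
  have "(\<Sum>n\<in>X. F n / of_real (real (\<Prod>i=1..k. n i) powr q))
      = (\<Sum>n\<in>X. \<Sum>e | e \<in> X \<and> tuple_dvd k e n. h e * of_real (\<Prod>i=1..k. real (e i) powr (-q))
          * of_real (\<Prod>i=1..k. (real (n i) / real (e i)) powr (r - q)))"
    using Fn by (rule sum.cong[OF refl])
  also have "\<dots> = (\<Sum>e\<in>X. \<Sum>n | n \<in> X \<and> tuple_dvd k e n. h e * of_real (\<Prod>i=1..k. real (e i) powr (-q))
          * of_real (\<Prod>i=1..k. (real (n i) / real (e i)) powr (r - q)))"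
    using X by (intro sum.swap_restrict) auto
  also have "\<dots> = (\<Sum>e\<in>X. h e * of_real (\<Prod>i=1..k. real (e i) powr (-q))
          * of_real (\<Sum>n | n \<in> X \<and> tuple_dvd k e n. \<Prod>i=1..k. (real (n i) / real (e i)) powr (r - q)))"
    by (simp add: sum_distrib_left)
  also have "\<dots> = (\<Sum>e\<in>X. h e * of_real (\<Prod>i=1..k. real (e i) powr (-q))
            * of_real (\<Prod>i=1..k. power_sum (r - q + 1) (x / real (e i))))"
    using X unfolding X_def by (intro sum.cong refl) (subst sum_multiple_tuples_powr, auto)
  finally show ?thesis unfolding X_def .
qed

lemma power_sum_lt_1: "y < 1 \<Longrightarrow> power_sum s y = 0"
  unfolding power_sum_def by (intro sum.neutral) auto

text \<open>Outside the box some \<open>x / e i\<close> is below 1 and its power sum is empty. This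
  lets the finite sum over e be read as a sum over all positive tuples.\<close>

lemma prod_power_sum_outside:
  assumes "e \<in> pos_tuples k" "e \<notin> pos_tuples_upto k x"
  shows "(\<Prod>i=1..k. power_sum s (x / real (e i))) = 0"
proof -
  obtain i where i: "i \<in> {1..k}" "real (e i) > x"
    using assms unfolding pos_tuples_def pos_tuples_upto_def by (force simp: PiE_iff not_le)
  hence "x / real (e i) < 1" using pos_tuplesD[OF assms(1) i(1)] by simp
  thus ?thesis using i(1) power_sum_lt_1 by (intro prod_zero) blast+
qed

lemma has_sum_sum:
  fixes f :: "'i \<Rightarrow> 'a \<Rightarrow> 'b::topological_comm_monoid_add"
  assumes "\<And>i. i \<in> I \<Longrightarrow> (f i has_sum S i) A"
  shows "((\<lambda>x. \<Sum>i\<in>I. f i x) has_sum (\<Sum>i\<in>I. S i)) A"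
  using assms by (induction I rule: infinite_finite_induct) (auto intro: has_sum_add)

lemma powr_scaled_div:
  fixes x e :: real
  assumes "x > 0" "e > 0"
  shows "e powr (-q) * (x / e) powr (r + 1 - q) = e powr (-(r + 1)) * x powr (r + 1 - q)"
proof -
  have "(x / e) powr (r + 1 - q) = x powr (r + 1 - q) * e powr (-(r + 1 - q))"
    unfolding powr_minus using assms by (simp add: powr_divide divide_inverse powr_mult inverse_powr)
  thus ?thesis using powr_add[of e "-q" "-(r + 1 - q)"] by simp
qed

text \<open>As s + q = r + 1, the factors \<open>e j powr (-q) * (x / e j) powr s\<close> combine to
  \<open>x powr s * e j powr (-(r+1))\<close> whatever q is, so the same summability hypotheses
  serve both sums. The factor \<open>(x / e i) powr (-b)\<close> of the error yields the gain
  \<open>x powr (-b)\<close> and the extra weight \<open>e i powr b\<close>.\<close>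

lemma sum_convolution_asymptotics:
  fixes F h :: "(nat \<Rightarrow> nat) \<Rightarrow> complex"
  assumes F: "\<And>n. n \<in> pos_tuples k \<Longrightarrow> F n =
      (\<Sum>e | e \<in> pos_tuples k \<and> tuple_dvd k e n. h e * (\<Prod>i=1..k. of_real ((real (n i) / real (e i)) powr r)))"
  assumes h0: "(\<lambda>e. norm (h e) * (\<Prod>j=1..k. real (e j) powr (-(r + 1)))) summable_on pos_tuples k"
  assumes h: "\<And>i. i \<in> {1..k} \<Longrightarrow>
      (\<lambda>e. norm (h e) * (\<Prod>j=1..k. real (e j) powr (-(r + 1) + (if j = i then b else 0)))) summable_on pos_tuples k"
  assumes s: "s = r + 1 - q" "s > 0" and b: "0 \<le> b" "b \<le> min s 1"
  shows "\<exists>K. \<forall>x\<ge>1.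
    norm ((\<Sum>n\<in>pos_tuples_upto k x. F n / of_real (real (\<Prod>i=1..k. n i) powr q))
      - (\<Sum>\<^sub>\<infinity>e\<in>pos_tuples k. h e * of_real (\<Prod>j=1..k. real (e j) powr (-(r + 1))))
        * of_real (x powr (real k * s) / s ^ k)) \<le> K * x powr (real k * s - b)"
proof -
  define T where "T = pos_tuples k"
  define w where "w = (\<lambda>i e. \<Prod>j=1..k. real (e j) powr (-(r + 1) + (if j = i then b else 0)))"
  define w0 where "w0 = (\<lambda>e. \<Prod>j=1..k. real (e j) powr (-(r + 1)))"
  obtain C where C: "C \<ge> 0" "\<And>y::nat \<Rightarrow> real. (\<And>i. i \<in> {1..k} \<Longrightarrow> y i > 0) \<Longrightarrow>
    \<bar>(\<Prod>i=1..k. power_sum s (y i)) - (\<Prod>i=1..k. y i powr s / s)\<bar>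
      \<le> C * (\<Sum>i=1..k. (\<Prod>j=1..k. y j powr s) * y i powr (-b))"
    using prod_power_sum_error[OF s(2) b, of "{1..k}"] by blast
  define K where "K = C * (\<Sum>i=1..k. \<Sum>\<^sub>\<infinity>e\<in>T. norm (h e) * w i e)"
  have "norm ((\<Sum>n\<in>pos_tuples_upto k x. F n / of_real (real (\<Prod>i=1..k. n i) powr q))
      - (\<Sum>\<^sub>\<infinity>e\<in>T. h e * of_real (w0 e)) * of_real (x powr (real k * s) / s ^ k))
      \<le> K * x powr (real k * s - b)" if x: "x \<ge> 1" for x
  proof -
    \<comment> \<open>\<open>u e\<close> is the exact contribution of e and \<open>v e\<close> its
      main term; both are summed over all tuples and compared term by term.\<close>
    define u where "u = (\<lambda>e. h e * of_real (\<Prod>i=1..k. real (e i) powr (-q))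
            * of_real (\<Prod>i=1..k. power_sum s (x / real (e i))))"
    define v where "v = (\<lambda>e. h e * of_real (\<Prod>i=1..k. real (e i) powr (-q))
            * of_real (\<Prod>i=1..k. (x / real (e i)) powr s / s))"
    have sum_eq: "(\<Sum>n\<in>pos_tuples_upto k x. F n / of_real (real (\<Prod>i=1..k. n i) powr q))
        = sum u (pos_tuples_upto k x)"
      unfolding u_def s(1) by (subst sum_convolution_tuples[OF F]) (simp_all add: algebra_simps)
    have hasu: "(u has_sum sum u (pos_tuples_upto k x)) T"
      using has_sum_finite[OF finite_pos_tuples_upto, of u k x]
      by (subst has_sum_cong_neutral[where T = "pos_tuples_upto k x" and g = u])
         (use pos_tuples_upto_subset[of k x] prod_power_sum_outside in \<open>auto simp: u_def T_def\<close>)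
    have v_eq: "v e = h e * of_real (w0 e) * of_real (x powr (real k * s) / s ^ k)" if "e \<in> T" for e
    proof -
      have "(\<Prod>i=1..k. real (e i) powr (-q)) * (\<Prod>i=1..k. (x / real (e i)) powr s / s)
          = (\<Prod>i=1..k. real (e i) powr (-q) * ((x / real (e i)) powr s / s))"
        by (simp only: prod.distrib)
      also have "\<dots> = (\<Prod>i=1..k. real (e i) powr (-(r + 1)) * (x powr s / s))"
      proof (intro prod.cong refl)
        fix i assume "i \<in> {1..k}"
        hence "real (e i) > 0" using pos_tuplesD that by (auto simp: T_def)
        thus "real (e i) powr (-q) * ((x / real (e i)) powr s / s) = real (e i) powr (-(r + 1)) * (x powr s / s)"
          using powr_scaled_div[of x "real (e i)" q r] x by (simp add: s(1))
      qed
      also have "\<dots> = w0 e * (x powr s / s) ^ k"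
        by (simp only: prod.distrib w0_def) simp
      also have "(x powr s / s) ^ k = x powr (real k * s) / s ^ k"
        using x by (simp add: power_divide powr_power mult.commute)
      finally show ?thesis unfolding v_def mult.assoc of_real_mult [symmetric] by simp
    qed
    have "(\<lambda>e. norm (h e * of_real (w0 e))) summable_on T"
      using h0 unfolding T_def w0_def norm_mult norm_of_real
      by (simp add: abs_prod)
    hence "((\<lambda>e. h e * of_real (w0 e)) has_sum (\<Sum>\<^sub>\<infinity>e\<in>T. h e * of_real (w0 e))) T"
      by (rule has_sum_infsum[OF abs_summable_summable])
    hence "((\<lambda>e. h e * of_real (w0 e) * of_real (x powr (real k * s) / s ^ k)) has_sum
        (\<Sum>\<^sub>\<infinity>e\<in>T. h e * of_real (w0 e)) * of_real (x powr (real k * s) / s ^ k)) T"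
      by (rule has_sum_cmult_left)
    hence "(v has_sum (\<Sum>\<^sub>\<infinity>e\<in>T. h e * of_real (w0 e)) * of_real (x powr (real k * s) / s ^ k)) T"
      using has_sum_cong[of T v, OF v_eq] by blast
    hence "((\<lambda>e. - v e) has_sum
        - ((\<Sum>\<^sub>\<infinity>e\<in>T. h e * of_real (w0 e)) * of_real (x powr (real k * s) / s ^ k))) T"
      by (simp only: has_sum_uminus minus_minus)
    from has_sum_add[OF hasu this]
    have 1: "((\<lambda>e. u e - v e) has_sum (sum u (pos_tuples_upto k x) -
        (\<Sum>\<^sub>\<infinity>e\<in>T. h e * of_real (w0 e)) * of_real (x powr (real k * s) / s ^ k))) T"
      by simp
    have "((\<lambda>e. norm (h e) * w i e) has_sum (\<Sum>\<^sub>\<infinity>e\<in>T. norm (h e) * w i e)) T" if "i \<in> {1..k}" for i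
      using h[OF that] unfolding w_def T_def by (rule has_sum_infsum)
    hence "((\<lambda>e. \<Sum>i=1..k. norm (h e) * w i e) has_sum (\<Sum>i=1..k. \<Sum>\<^sub>\<infinity>e\<in>T. norm (h e) * w i e)) T"
      by (intro has_sum_sum) auto
    from has_sum_cmult_right[OF this, of "x powr (real k * s - b) * C"]
    have 2: "((\<lambda>e. x powr (real k * s - b) * C * (\<Sum>i=1..k. norm (h e) * w i e)) has_sum K * x powr (real k * s - b)) T"
      unfolding K_def by (simp add: mult_ac)
    have 3: "norm (u e - v e) \<le> x powr (real k * s - b) * C * (\<Sum>i=1..k. norm (h e) * w i e)" if e: "e \<in> T" for e
    proof -
      have pos: "e i > 0" if "i \<in> {1..k}" for i using pos_tuplesD[of e k] e that by (simp add: T_def)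
      have "norm (u e - v e) = norm (h e) * (\<Prod>i=1..k. real (e i) powr (-q)) *
        \<bar>(\<Prod>i=1..k. power_sum s (x / real (e i))) - (\<Prod>i=1..k. (x / real (e i)) powr s / s)\<bar>"
        unfolding u_def v_def right_diff_distrib [symmetric] of_real_diff [symmetric] norm_mult norm_of_real
        by (simp add: abs_prod)
      also have "\<dots> \<le> norm (h e) * (\<Prod>i=1..k. real (e i) powr (-q)) *
        (C * (\<Sum>i=1..k. (\<Prod>j=1..k. (x / real (e j)) powr s) * (x / real (e i)) powr (-b)))"
        using x pos by (intro mult_left_mono C(2) mult_nonneg_nonneg prod_nonneg) auto
      also have "\<dots> = C * (\<Sum>i=1..k. norm (h e) * ((\<Prod>i=1..k. real (e i) powr (-q)) *
          ((\<Prod>j=1..k. (x / real (e j)) powr s) * (x / real (e i)) powr (-b))))"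
        by (simp add: sum_distrib_left mult_ac)
      also have "\<dots> = C * (\<Sum>i=1..k. norm (h e) * (x powr (real k * s - b) * w i e))"
      proof (intro sum.cong refl arg_cong[of _ _ "(*) C"] arg_cong[of _ _ "(*) (norm (h e))"])
        fix i assume i: "i \<in> {1..k}"
        have "w i e = (\<Prod>j=1..k. real (e j) powr (-(r+1)) * (if j = i then real (e j) powr b else 1))"
          unfolding w_def by (intro prod.cong) (auto simp: powr_add [symmetric])
        also have "\<dots> = w0 e * real (e i) powr b"
          using i by (simp add: prod.distrib w0_def prod.delta)
        finally have w: "w i e = w0 e * real (e i) powr b" .
        have "(\<Prod>i=1..k. real (e i) powr (-q)) * (\<Prod>j=1..k. (x / real (e j)) powr s)
            = (\<Prod>j=1..k. real (e j) powr (-(r+1)) * x powr s)"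
          unfolding prod.distrib [symmetric] s(1) using x pos
          by (intro prod.cong refl powr_scaled_div) auto
        also have "\<dots> = w0 e * x powr (real k * s)"
          unfolding prod.distrib w0_def using x by (simp add: powr_power mult.commute)
        finally have "(\<Prod>i=1..k. real (e i) powr (-q)) * (\<Prod>j=1..k. (x / real (e j)) powr s)
            = w0 e * x powr (real k * s)" .
        moreover have "(x / real (e i)) powr (-b) = x powr (-b) * real (e i) powr b"
          unfolding powr_minus powr_divide by (simp add: field_simps)
        moreover have "x powr (real k * s - b) = x powr (real k * s) * x powr (-b)"
          by (simp add: powr_add [symmetric])
        ultimately show "(\<Prod>i=1..k. real (e i) powr (-q)) *
          ((\<Prod>j=1..k. (x / real (e j)) powr s) * (x / real (e i)) powr (-b)) = x powr (real k * s - b) * w i e"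
          unfolding mult.assoc [symmetric] w by simp
      qed
      finally show ?thesis by (simp add: sum_distrib_left mult_ac)
    qed
    show ?thesis unfolding sum_eq by (rule norm_infsum_le[OF 1 2 3])
  qed
  thus ?thesis unfolding T_def w0_def by blast
qed

section \<open>Inversion of local series\<close>

text \<open>The coefficients of \<open>(1 - q z\<^sub>1) \<dots> (1 - q z\<^sub>k) \<Sum>\<^sub>\<nu> G \<nu> z\<^sup>\<nu>\<close>.\<close>
definition local_coeff :: "nat \<Rightarrow> complex \<Rightarrow> ((nat \<Rightarrow> nat) \<Rightarrow> complex) \<Rightarrow> (nat \<Rightarrow> nat) \<Rightarrow> complex" where
  "local_coeff k q G \<mu> = (\<Sum>D\<in>Pow {i\<in>{1..k}. \<mu> i \<ge> 1}.
     (-q) ^ card D * G (\<lambda>i\<in>{1..k}. \<mu> i - of_bool (i \<in> D)))"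

lemma sum_of_bool_mem:
  assumes "finite A" "D \<subseteq> A"
  shows "(\<Sum>i\<in>A. of_bool (i \<in> D)) = (of_nat (card D) :: 'a::semiring_1)"
proof -
  have "(\<Sum>i\<in>A. of_bool (i \<in> D)) = (\<Sum>i\<in>D. 1 :: 'a)"
    using assms by (intro sum.mono_neutral_cong_right) auto
  thus ?thesis by simp
qed

lemma sum_Pow_minus_one_power:
  assumes "finite A"
  shows "(\<Sum>D\<in>Pow A. (-1) ^ card D) = (if A = {} then 1 else 0 :: 'a::comm_ring_1)"
proof -
  have "(\<Sum>D\<in>Pow A. (-1) ^ card D) = (\<Prod>i\<in>A. (-1) + 1 :: 'a)"
    by (subst prod_add[OF assms]) simp
  thus ?thesis using assms by (simp add: card_gt_0_iff zero_power)
qed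

text \<open>This is the coefficient form of multiplying back by the geometric series
  \<open>1 / (1 - q z_i)\<close>. After collecting the terms with the same shifted tuple \<rho>, the
  factor of \<open>G \<rho>\<close> contains the alternating sum over all subsets of the coordinates
  with \<open>\<rho> i < \<nu> i\<close>, which vanishes unless \<rho> = \<nu>.\<close>

lemma local_coeff_inversion:
  assumes \<nu>: "\<nu> \<in> exponent_tuples k"
  shows "(\<Sum>\<mu>\<in>PiE {1..k} (\<lambda>i. {..\<nu> i}). local_coeff k q G \<mu> * q ^ (\<Sum>i=1..k. \<nu> i - \<mu> i)) = G \<nu>"
proof -
  define I where "I = {1..k}"
  define B where "B = PiE I (\<lambda>i. {..\<nu> i})"
  have [simp]: "finite I" "finite B" unfolding I_def B_def by (auto intro: finite_PiE)
  define shift where "shift = (\<lambda>\<mu> D. \<lambda>i\<in>I. \<mu> i - of_bool (i \<in> D) :: nat)"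
  define unshift where "unshift = (\<lambda>\<mu> D. \<lambda>i\<in>I. \<mu> i + of_bool (i \<in> D) :: nat)"
  have "(\<Sum>\<mu>\<in>B. local_coeff k q G \<mu> * q ^ (\<Sum>i\<in>I. \<nu> i - \<mu> i))
      = (\<Sum>\<mu>\<in>B. \<Sum>D\<in>Pow {i\<in>I. \<mu> i \<ge> 1}. (-q) ^ card D * G (shift \<mu> D) * q ^ (\<Sum>i\<in>I. \<nu> i - \<mu> i))"
    unfolding local_coeff_def I_def shift_def by (simp add: sum_distrib_right)
  also have "\<dots> = (\<Sum>(\<mu>,D)\<in>Sigma B (\<lambda>\<mu>. Pow {i\<in>I. \<mu> i \<ge> 1}).
      (-q) ^ card D * G (shift \<mu> D) * q ^ (\<Sum>i\<in>I. \<nu> i - \<mu> i))"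
    by (subst sum.Sigma) auto
  also have "\<dots> = (\<Sum>(\<rho>,D)\<in>Sigma B (\<lambda>\<rho>. Pow {i\<in>I. \<rho> i < \<nu> i}).
      (-1) ^ card D * (G \<rho> * q ^ (\<Sum>i\<in>I. \<nu> i - \<rho> i)))"
  \<comment> \<open>Here \<rho> is \<mu> lowered by 1 on D. The truncated subtraction is exact
    because \<mu> is positive on D, and the power \<open>q ^ card D\<close> is absorbed into the
    exponent: the entries of \<nu> - \<rho> sum to those of \<nu> - \<mu> plus
    \<open>card D\<close>.\<close>
  proof (rule sum.reindex_bij_witness[of _ "\<lambda>(\<rho>,D). (unshift \<rho> D, D)" "\<lambda>(\<mu>,D). (shift \<mu> D, D)"])
    fix a assume a: "a \<in> Sigma B (\<lambda>\<mu>. Pow {i\<in>I. \<mu> i \<ge> 1})"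
    then obtain \<mu> D where aD: "a = (\<mu>, D)" "\<mu> \<in> B" "D \<subseteq> {i\<in>I. \<mu> i \<ge> 1}" by auto
    show "(case case a of (\<mu>, D) \<Rightarrow> (shift \<mu> D, D) of (\<rho>, D) \<Rightarrow> (unshift \<rho> D, D)) = a"
      using aD by (auto simp: shift_def unshift_def B_def PiE_iff extensional_def fun_eq_iff)
    show "(case a of (\<mu>, D) \<Rightarrow> (shift \<mu> D, D)) \<in> Sigma B (\<lambda>\<rho>. Pow {i\<in>I. \<rho> i < \<nu> i})"
      using aD by (fastforce simp: shift_def B_def PiE_iff)
    have "(\<Sum>i\<in>I. \<nu> i - shift \<mu> D i) = (\<Sum>i\<in>I. (\<nu> i - \<mu> i) + of_bool (i \<in> D))"
      using aD by (intro sum.cong) (force simp: shift_def B_def PiE_iff)+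
    also have "\<dots> = (\<Sum>i\<in>I. \<nu> i - \<mu> i) + card D"
      using sum_of_bool_mem[of I D, where 'a = nat] aD by (subst sum.distrib) auto
    finally have e: "(\<Sum>i\<in>I. \<nu> i - shift \<mu> D i) = (\<Sum>i\<in>I. \<nu> i - \<mu> i) + card D" .
    show "(case case a of (\<mu>, D) \<Rightarrow> (shift \<mu> D, D) of
          (\<rho>, D) \<Rightarrow> (-1) ^ card D * (G \<rho> * q ^ (\<Sum>i\<in>I. \<nu> i - \<rho> i))) =
         (case a of (\<mu>, D) \<Rightarrow> (-q) ^ card D * G (shift \<mu> D) * q ^ (\<Sum>i\<in>I. \<nu> i - \<mu> i))"
      unfolding aD prod.case e by (simp add: power_add power_minus[of q] mult_ac)
  next
    fix a assume a: "a \<in> Sigma B (\<lambda>\<rho>. Pow {i\<in>I. \<rho> i < \<nu> i})"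
    then obtain \<rho> D where aD: "a = (\<rho>, D)" "\<rho> \<in> B" "D \<subseteq> {i\<in>I. \<rho> i < \<nu> i}" by auto
    show "(case case a of (\<rho>, D) \<Rightarrow> (unshift \<rho> D, D) of (\<mu>, D) \<Rightarrow> (shift \<mu> D, D)) = a"
      using aD by (auto simp: shift_def unshift_def B_def PiE_iff extensional_def fun_eq_iff)
    show "(case a of (\<rho>, D) \<Rightarrow> (unshift \<rho> D, D)) \<in> Sigma B (\<lambda>\<mu>. Pow {i\<in>I. \<mu> i \<ge> 1})"
      using aD by (fastforce simp: unshift_def B_def PiE_iff Suc_le_eq)
  qed
  also have "\<dots> = (\<Sum>\<rho>\<in>B. (\<Sum>D\<in>Pow {i\<in>I. \<rho> i < \<nu> i}. (-1) ^ card D) * (G \<rho> * q ^ (\<Sum>i\<in>I. \<nu> i - \<rho> i)))"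
    by (subst sum.Sigma [symmetric]) (auto simp: sum_distrib_right)
  also have "\<dots> = (\<Sum>\<rho>\<in>B. if \<rho> = \<nu> then G \<nu> else 0)"
  proof (rule sum.cong[OF refl])
    fix \<rho> assume \<rho>: "\<rho> \<in> B"
    have "\<rho> = \<nu>" if "{i\<in>I. \<rho> i < \<nu> i} = {}"
    proof
      fix i
      have "\<rho> i = \<nu> i" if "i \<in> I" using that \<open>{i\<in>I. \<rho> i < \<nu> i} = {}\<close> \<rho>
        by (intro le_antisym) (auto simp: B_def PiE_iff not_less)
      thus "\<rho> i = \<nu> i"
        using \<rho> \<nu> by (cases "i \<in> I") (auto simp: B_def exponent_tuples_def I_def PiE_iff extensional_def)
    qed
    thus "(\<Sum>D\<in>Pow {i\<in>I. \<rho> i < \<nu> i}. (-1) ^ card D) * (G \<rho> * q ^ (\<Sum>i\<in>I. \<nu> i - \<rho> i))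
        = (if \<rho> = \<nu> then G \<nu> else 0)"
      by (subst sum_Pow_minus_one_power) auto
  qed
  also have "\<dots> = G \<nu>"
    using \<nu> by (subst sum.delta[OF \<open>finite B\<close>]) (auto simp: B_def exponent_tuples_def I_def PiE_iff)
  finally show ?thesis unfolding B_def I_def .
qed

text \<open>All variables are specialised to one z. Each subset D contributes a copy of the series
  shifted by 1 on D, hence multiplied by \<open>(- (q * z)) ^ card D\<close>, and summing over D
  gives \<open>(1 - q * z) ^ k\<close>.\<close>

lemma local_coeff_has_sum:
  assumes G: "((\<lambda>\<nu>. G \<nu> * z ^ (\<Sum>i=1..k. \<nu> i)) has_sum A) (exponent_tuples k)"
  shows "((\<lambda>\<mu>. local_coeff k q G \<mu> * z ^ (\<Sum>i=1..k. \<mu> i)) has_sum (1 - q * z) ^ k * A) (exponent_tuples k)"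
proof -
  define I where "I = {1..k}"
  have [simp]: "finite I" by (simp add: I_def)
  define shift where "shift = (\<lambda>D \<mu>. \<lambda>i\<in>I. \<mu> i - of_bool (i \<in> D) :: nat)"
  define unshift where "unshift = (\<lambda>D \<mu>. \<lambda>i\<in>I. \<mu> i + of_bool (i \<in> D) :: nat)"
  \<comment> \<open>Extended by 0 where the shift is impossible, so that the finitely many shifted
    series have the common index set \<open>exponent_tuples k\<close>.\<close>
  define t where "t = (\<lambda>D \<mu>. if D \<subseteq> {i\<in>I. \<mu> i \<ge> 1} then (-q) ^ card D * G (shift D \<mu>) * z ^ (\<Sum>i\<in>I. \<mu> i) else 0)"
  have t: "(t D has_sum (- (q * z)) ^ card D * A) (exponent_tuples k)" if D: "D \<in> Pow I" for D
  proof -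
    have "((\<lambda>\<nu>. (- (q * z)) ^ card D * (G \<nu> * z ^ (\<Sum>i\<in>I. \<nu> i))) has_sum (- (q * z)) ^ card D * A) (exponent_tuples k)"
      using has_sum_cmult_right[OF G] unfolding I_def .
    also have "?this \<longleftrightarrow> ((\<lambda>\<mu>. (-q) ^ card D * G (shift D \<mu>) * z ^ (\<Sum>i\<in>I. \<mu> i)) has_sum (- (q * z)) ^ card D * A)
        {\<mu>\<in>exponent_tuples k. D \<subseteq> {i\<in>I. \<mu> i \<ge> 1}}"
    proof (rule has_sum_reindex_bij_witness[of _ "shift D" "unshift D"])
      fix \<nu> assume \<nu>: "\<nu> \<in> exponent_tuples k"
      show "shift D (unshift D \<nu>) = \<nu>"
        using \<nu> by (auto simp: shift_def unshift_def exponent_tuples_def PiE_iff extensional_def fun_eq_iff I_def)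
      show "unshift D \<nu> \<in> {\<mu>\<in>exponent_tuples k. D \<subseteq> {i\<in>I. \<mu> i \<ge> 1}}"
        using \<nu> D by (auto simp: unshift_def exponent_tuples_def I_def)
      have "(\<Sum>i\<in>I. unshift D \<nu> i) = (\<Sum>i\<in>I. \<nu> i) + card D"
        using D sum_of_bool_mem[of I D, where 'a = nat] by (simp add: unshift_def sum.distrib)
      thus "(- q) ^ card D * G (shift D (unshift D \<nu>)) * z ^ (\<Sum>i\<in>I. unshift D \<nu> i) =
            (- (q * z)) ^ card D * (G \<nu> * z ^ (\<Sum>i\<in>I. \<nu> i))"
        unfolding \<open>shift D (unshift D \<nu>) = \<nu>\<close>
        by (simp add: power_add power_mult_distrib power_minus[of q] power_minus[of "q * z"])
    next
      fix \<mu> assume \<mu>: "\<mu> \<in> {\<mu>\<in>exponent_tuples k. D \<subseteq> {i\<in>I. \<mu> i \<ge> 1}}"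
      show "unshift D (shift D \<mu>) = \<mu>"
        using \<mu> by (auto simp: shift_def unshift_def exponent_tuples_def PiE_iff extensional_def fun_eq_iff I_def)
      show "shift D \<mu> \<in> exponent_tuples k"
        by (auto simp: shift_def exponent_tuples_def I_def)
    qed auto
    also have "\<dots> \<longleftrightarrow> (t D has_sum (- (q * z)) ^ card D * A) (exponent_tuples k)"
      by (rule has_sum_cong_neutral) (auto simp: t_def)
    finally show ?thesis .
  qed
  have "(\<Sum>D\<in>Pow I. (- (q * z)) ^ card D * A) = (\<Prod>i\<in>I. - (q * z) + 1) * A"
    unfolding sum_distrib_right [symmetric] by (subst prod_add) simp_all
  hence "((\<lambda>\<mu>. \<Sum>D\<in>Pow I. t D \<mu>) has_sum (1 - q * z) ^ k * A) (exponent_tuples k)"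
    using has_sum_sum[of "Pow I" t, OF t] by (simp add: I_def)
  moreover have "(\<Sum>D\<in>Pow I. t D \<mu>) = local_coeff k q G \<mu> * z ^ (\<Sum>i=1..k. \<mu> i)" for \<mu>
  proof -
    have "(\<Sum>D\<in>Pow I. t D \<mu>) = (\<Sum>D\<in>Pow {i\<in>I. \<mu> i \<ge> 1}. (-q) ^ card D * G (shift D \<mu>) * z ^ (\<Sum>i\<in>I. \<mu> i))"
      by (intro sum.mono_neutral_cong_right) (auto simp: t_def)
    thus ?thesis by (simp add: local_coeff_def sum_distrib_right shift_def I_def)
  qed
  ultimately show ?thesis by simp
qed

section \<open>The trivial exponent tuple and geometric majorants over exponent tuples\<close>

definition zero_tuple :: "nat \<Rightarrow> nat \<Rightarrow> nat" where
  "zero_tuple k = (\<lambda>i\<in>{1..k}. 0)"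

lemma zero_tuple_in: "zero_tuple k \<in> exponent_tuples k"
  by (auto simp: zero_tuple_def exponent_tuples_def)

lemma zero_tuple_iff:
  assumes "\<mu> \<in> exponent_tuples k"
  shows "\<mu> = zero_tuple k \<longleftrightarrow> (\<Sum>i=1..k. \<mu> i) = 0"
proof
  assume "(\<Sum>i=1..k. \<mu> i) = 0"
  thus "\<mu> = zero_tuple k" using assms
    by (auto simp: zero_tuple_def exponent_tuples_def PiE_iff extensional_def fun_eq_iff)
qed (simp add: zero_tuple_def)

lemma local_coeff_zero_tuple: "local_coeff k q G (zero_tuple k) = G (zero_tuple k)"
proof -
  have 1: "{i\<in>{1..k}. zero_tuple k i \<ge> 1} = {}" by (auto simp: zero_tuple_def)
  have 2: "(\<lambda>i\<in>{1..k}. zero_tuple k i - of_bool (i \<in> {})) = zero_tuple k"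
    by (auto simp: zero_tuple_def fun_eq_iff)
  show ?thesis unfolding local_coeff_def 1 Pow_empty by (simp add: 2[simplified])
qed

text \<open>A finite F lies in the box spanned by its coordinate projections, and over a box the sum
  of products factors. It is applied with I the set of coordinates and again with I a finite set of
  primes.\<close>

lemma prod_sum_PiE_le:
  fixes g :: "'i \<Rightarrow> 'a \<Rightarrow> real"
  assumes "finite I" "finite F" "F \<subseteq> PiE I B"
    and nonneg: "\<And>i x. i \<in> I \<Longrightarrow> x \<in> B i \<Longrightarrow> g i x \<ge> 0"
    and S: "\<And>i. i \<in> I \<Longrightarrow> (g i has_sum S i) (B i)"
  shows "(\<Sum>\<phi>\<in>F. \<Prod>i\<in>I. g i (\<phi> i)) \<le> (\<Prod>i\<in>I. S i)"
proof -
  define B' where "B' = (\<lambda>i. (\<lambda>\<phi>. \<phi> i) ` F)"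
  have B': "finite (B' i)" "i \<in> I \<Longrightarrow> B' i \<subseteq> B i" for i
    using assms(2,3) by (auto simp: B'_def PiE_iff)
  have "(\<Sum>\<phi>\<in>F. \<Prod>i\<in>I. g i (\<phi> i)) \<le> (\<Sum>\<phi>\<in>PiE I B'. \<Prod>i\<in>I. g i (\<phi> i))"
  proof (rule sum_mono2)
    show "F \<subseteq> PiE I B'" using assms(3) by (auto simp: B'_def PiE_iff)
    show "(\<Prod>i\<in>I. g i (\<phi> i)) \<ge> 0" if "\<phi> \<in> PiE I B' - F" for \<phi>
      using that B' by (intro prod_nonneg) (auto simp: PiE_iff intro!: nonneg)
  qed (use assms(1) B' in \<open>auto intro: finite_PiE\<close>)
  also have "\<dots> = (\<Prod>i\<in>I. \<Sum>x\<in>B' i. g i x)"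
    using assms(1) B' by (subst prod_sum_PiE) auto
  also have "\<dots> \<le> (\<Prod>i\<in>I. S i)"
    using B' nonneg
    by (intro prod_mono conjI sum_nonneg finite_sum_le_has_sum[OF S]) (auto intro!: nonneg)
  finally show ?thesis .
qed

lemma summable_power_exponent_tuples:
  fixes u :: real
  assumes "0 \<le> u" "u < 1"
  shows "(\<lambda>\<mu>. u ^ (\<Sum>i=1..k. \<mu> i)) summable_on exponent_tuples k"
proof (rule nonneg_bdd_above_summable_on)
  have S: "((\<lambda>n. u ^ n) has_sum (\<Sum>n. u ^ n)) UNIV"
    using assms by (intro sums_nonneg_imp_has_sum summable_sums summable_geometric) auto
  show "bdd_above (sum (\<lambda>\<mu>. u ^ (\<Sum>i=1..k. \<mu> i)) ` {F. F \<subseteq> exponent_tuples k \<and> finite F})"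
  proof (rule bdd_aboveI2)
    fix F assume F: "F \<in> {F. F \<subseteq> exponent_tuples k \<and> finite F}"
    have "(\<Sum>\<mu>\<in>F. \<Prod>i=1..k. u ^ \<mu> i) \<le> (\<Prod>i=1..k. \<Sum>n. u ^ n)"
      using F assms S by (intro prod_sum_PiE_le[where B = "\<lambda>_. UNIV"]) (auto simp: exponent_tuples_def)
    thus "(\<Sum>\<mu>\<in>F. u ^ (\<Sum>i=1..k. \<mu> i)) \<le> (\<Prod>i=1..k. \<Sum>n. u ^ n)"
      by (simp add: power_sum)
  qed
qed (use assms in auto)

section \<open>Bounds for the local coefficients\<close>

text \<open>In the application t is the size of the subset D in \<open>local_coeff\<close>, m and L
  are the maximum and the sum of the reduced exponents, and \<sigma> = r + 1; the left side bounds
  from below the exponent of 1/p in one weighted summand. The first bound gives geometric decay in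
  the total exponent t + L, the second an exponent above 1 for the sum over primes.\<close>

lemma exponent_bound:
  fixes b \<sigma> :: real and t m L :: nat
  assumes "m \<le> L" "m = 0 \<Longrightarrow> L = 0" "0 \<le> b" "b < min \<sigma> 1 / 2"
  defines "c \<equiv> min \<sigma> 1 / 2"
  shows "(1 - b) * (real t + real m) + \<sigma> * (real L - real m) \<ge> c * (real t + real L)"
    and "t + L \<ge> 2 \<Longrightarrow> (1 - b) * (real t + real m) + \<sigma> * (real L - real m) \<ge> 1 + (c - b)"
proof -
  have c: "c > 0" "c \<le> 1/2" "2 * c \<le> \<sigma>" "b < c" using assms by (auto simp: c_def)
  have Lm: "real L - real m \<ge> 0" using assms by simp
  have "c * (real t + real m) \<le> (1 - b) * (real t + real m)" using c by (intro mult_right_mono) auto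
  moreover have *: "c * (real L - real m) \<le> \<sigma> * (real L - real m)" using c Lm by (intro mult_right_mono) auto
  ultimately show "(1 - b) * (real t + real m) + \<sigma> * (real L - real m) \<ge> c * (real t + real L)"
    by (simp add: algebra_simps)
  assume tL: "t + L \<ge> 2"
  show "(1 - b) * (real t + real m) + \<sigma> * (real L - real m) \<ge> 1 + (c - b)"
  proof (cases "t + m \<ge> 2")
    case True
    hence "(1 - b) * 2 \<le> (1 - b) * (real t + real m)" using c by (intro mult_left_mono) auto
    moreover have "0 \<le> \<sigma> * (real L - real m)" using c Lm by (intro mult_nonneg_nonneg) auto
    moreover have "(1 - b) * 2 = 2 - 2 * b" by simp
    ultimately show ?thesis using c by linarith
  next
    case False
    \<comment> \<open>m = 0 would force L = 0 and hence t \<ge> 2, against t + m < 2. What is left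
      is a prime occurring to at most the first power but in at least two entries.\<close>
    with tL assms(1,2) have *: "t = 0" "m = 1" "L \<ge> 2" by (cases m; auto)+
    have "\<sigma> * 1 \<le> \<sigma> * (real L - real m)" using c * by (intro mult_left_mono) auto
    moreover have "(1 - b) * (real t + real m) = 1 - b" using * by simp
    ultimately show ?thesis using c by linarith
  qed
qed

lemma class_A_prime_power_bound:
  assumes "f \<in> class_A r"
  obtains C where "C \<ge> 0" "\<And>p m. prime p \<Longrightarrow> norm (f (p ^ m)) \<le> C * real p powr (r * real m)"
proof -
  obtain C1 C2 where C1: "\<And>p. prime p \<Longrightarrow> norm (f p - of_real (real p powr r)) \<le> C1 * real p powr (r - 1/2)"
    and C2: "\<And>p \<nu>. prime p \<Longrightarrow> \<nu> \<ge> 2 \<Longrightarrow> norm (f (p ^ \<nu>)) \<le> C2 * real p powr (real \<nu> * r)"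
    and f1: "f 1 = 1"
    using assms unfolding class_A_def multiplicative_arith_def by blast
  define C where "C = 1 + \<bar>C1\<bar> + \<bar>C2\<bar>"
  have "norm (f (p ^ m)) \<le> C * real p powr (r * real m)" if p: "prime p" for p m
  proof -
    have p2: "real p \<ge> 2" using prime_ge_2_nat[OF p] by simp
    consider "m = 0" | "m = 1" | "m \<ge> 2" by linarith
    thus ?thesis
    proof cases
      case 1
      thus ?thesis using f1 p2 by (simp add: C_def)
    next
      case 2
      have "norm (f p) \<le> norm (of_real (real p powr r) :: complex) + norm (f p - of_real (real p powr r))"
        using norm_triangle_sub by blast
      also have "\<dots> \<le> real p powr r + \<bar>C1\<bar> * real p powr (r - 1/2)"
        using C1[OF p] mult_right_mono[OF abs_ge_self[of C1], of "real p powr (r - 1/2)"]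
        by simp
      also have "\<dots> \<le> real p powr r + \<bar>C1\<bar> * real p powr r"
        using p2 by (intro add_left_mono mult_left_mono powr_mono) auto
      also have "\<dots> \<le> C * real p powr r" by (simp add: C_def algebra_simps)
      finally show ?thesis using 2 by simp
    next
      case 3
      have "norm (f (p ^ m)) \<le> C2 * real p powr (r * real m)" using C2[OF p 3] by (simp add: mult.commute)
      also have "\<dots> \<le> C * real p powr (r * real m)" by (intro mult_right_mono) (auto simp: C_def)
      finally show ?thesis .
    qed
  qed
  moreover have "C \<ge> 0" by (simp add: C_def)
  ultimately show ?thesis using that by blast
qed

section \<open>Decay of the local coefficients of \<open>f\<close> at a single prime\<close>

definition lcm_local :: "(nat \<Rightarrow> complex) \<Rightarrow> nat \<Rightarrow> nat \<Rightarrow> (nat \<Rightarrow> nat) \<Rightarrow> complex" where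
  "lcm_local f k p \<nu> = f (p ^ Max (\<nu> ` {1..k}))"

text \<open>The choice q = \<open>p powr r\<close> is dictated by the comparison function
  \<open>(n_1 ... n_k) powr r\<close>, whose local series is the product of the
  \<open>1 / (1 - p powr r * z_i)\<close>.\<close>

definition lcm_local_coeff :: "real \<Rightarrow> (nat \<Rightarrow> complex) \<Rightarrow> nat \<Rightarrow> nat \<Rightarrow> (nat \<Rightarrow> nat) \<Rightarrow> complex" where
  "lcm_local_coeff r f k p = local_coeff k (of_real (real p powr r)) (lcm_local f k p)"

lemma Max_image_facts:
  fixes \<nu> :: "nat \<Rightarrow> nat"
  assumes "k \<ge> 1"
  shows "Max (\<nu> ` {1..k}) \<le> (\<Sum>i=1..k. \<nu> i)" "Max (\<nu> ` {1..k}) = 0 \<Longrightarrow> (\<Sum>i=1..k. \<nu> i) = 0"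
    "i \<in> {1..k} \<Longrightarrow> \<nu> i \<le> Max (\<nu> ` {1..k})"
proof -
  have "Max (\<nu> ` {1..k}) \<in> \<nu> ` {1..k}" using assms by (intro Max_in) auto
  then obtain j where "j \<in> {1..k}" "Max (\<nu> ` {1..k}) = \<nu> j" by auto
  thus "Max (\<nu> ` {1..k}) \<le> (\<Sum>i=1..k. \<nu> i)" by (simp add: member_le_sum)
  show 3: "\<nu> i \<le> Max (\<nu> ` {1..k})" if "i \<in> {1..k}" for i using that by (intro Max_ge) auto
  show "(\<Sum>i=1..k. \<nu> i) = 0" if "Max (\<nu> ` {1..k}) = 0" using 3 that by (intro sum.neutral ballI) (metis le_zero_eq)
qed

text \<open>Only coordinate i carries the extra b, so a bound M for single entries suffices. An
  index i outside \<open>{1..k}\<close> is allowed and stands for the weight without extra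
  b.\<close>

lemma weight_exponent_le:
  fixes \<mu> :: "nat \<Rightarrow> nat" and a :: "nat \<Rightarrow> real"
  assumes a: "\<And>j. j \<in> {1..k} \<Longrightarrow> a j \<le> -\<sigma> + (if j = i then b else 0)" and "b \<ge> 0"
    and M: "\<And>j. j \<in> {1..k} \<Longrightarrow> \<mu> j \<le> M"
  shows "(\<Sum>j=1..k. a j * real (\<mu> j)) \<le> -\<sigma> * real (\<Sum>j=1..k. \<mu> j) + b * real M"
proof -
  have "(\<Sum>j=1..k. a j * real (\<mu> j)) \<le> (\<Sum>j=1..k. -\<sigma> * real (\<mu> j) + (if j = i then b * real (\<mu> j) else 0))"
  proof (rule sum_mono)
    fix j assume "j \<in> {1..k}"
    hence "a j * real (\<mu> j) \<le> (-\<sigma> + (if j = i then b else 0)) * real (\<mu> j)"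
      using a by (intro mult_right_mono) auto
    thus "a j * real (\<mu> j) \<le> -\<sigma> * real (\<mu> j) + (if j = i then b * real (\<mu> j) else 0)"
      by (auto simp: algebra_simps)
  qed
  also have "\<dots> = -\<sigma> * real (\<Sum>j=1..k. \<mu> j) + (if i \<in> {1..k} then b * real (\<mu> i) else 0)"
    unfolding sum.distrib by (simp add: sum_distrib_left sum.delta sum_negf)
  also have "\<dots> \<le> -\<sigma> * real (\<Sum>j=1..k. \<mu> j) + b * real M"
    using assms(2) M by (auto intro: mult_left_mono)
  finally show ?thesis .
qed

text \<open>Separates a factor summable over p from a factor geometric in n and uniform in p: the
  exponent X + 1 + \<eta> is at most 0, so the base p \<ge> 2 may be lowered to 2.\<close>

lemma powr_le_powr_times_power:
  fixes p c \<eta> X :: real and n :: nat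
  assumes p: "p \<ge> 2" and X: "X \<le> -(1 + \<eta>)" "X \<le> -(c * real n)" and "\<eta> \<ge> 0"
  shows "p powr X \<le> 2 powr (1 + \<eta>) * p powr (-(1 + \<eta>)) * (2 powr (-c)) ^ n"
proof -
  have "p powr X = p powr (-(1 + \<eta>)) * p powr (X + 1 + \<eta>)"
    using p by (simp add: powr_add [symmetric])
  also have "\<dots> \<le> p powr (-(1 + \<eta>)) * 2 powr (X + 1 + \<eta>)"
    using p X by (intro mult_left_mono powr_mono2') auto
  also have "\<dots> \<le> p powr (-(1 + \<eta>)) * 2 powr ((1 + \<eta>) + (-c) * real n)"
    using X by (intro mult_left_mono powr_mono) auto
  also have "2 powr ((1 + \<eta>) + (-c) * real n) = 2 powr (1 + \<eta>) * (2 powr (-c)) ^ n"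
    unfolding powr_add[of 2 "1 + \<eta>"] by (simp add: powr_power mult.commute)
  finally show ?thesis by (simp add: mult_ac)
qed

text \<open>
  The coefficient at a unit vector is \<open>f p - p powr r\<close>; at every other nonzero vector already the
  individual summands of \<open>local_coeff\<close> are small enough.
\<close>
lemma lcm_local_coeff_bound:
  assumes k: "k \<ge> 1" and r: "r > -1" and f: "f \<in> class_A r" and b: "0 \<le> b" "b < min (r + 1) 1 / 2"
  defines "c \<equiv> min (r + 1) 1 / 2"
  obtains K where "K \<ge> 0"
    "\<And>p \<mu> a i. prime p \<Longrightarrow> \<mu> \<in> exponent_tuples k \<Longrightarrow> \<mu> \<noteq> zero_tuple k \<Longrightarrow>
       (\<And>j. j \<in> {1..k} \<Longrightarrow> a j \<le> -(r + 1) + (if j = i then b else 0)) \<Longrightarrow>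
       norm (lcm_local_coeff r f k p \<mu>) * real p powr (\<Sum>j=1..k. a j * real (\<mu> j))
         \<le> K * real p powr (-(1 + (c - b))) * (2 powr (-c)) ^ (\<Sum>j=1..k. \<mu> j)"
proof -
  obtain C where C: "C \<ge> 0" "\<And>p m. prime p \<Longrightarrow> norm (f (p ^ m)) \<le> C * real p powr (r * real m)"
    using class_A_prime_power_bound[OF f] by blast
  obtain C1 where C1: "\<And>p. prime p \<Longrightarrow> norm (f p - of_real (real p powr r)) \<le> C1 * real p powr (r - 1/2)"
    and f1: "f 1 = 1"
    using f unfolding class_A_def multiplicative_arith_def by blast
  \<comment> \<open>The first part serves the unit vectors. The second serves all other nonzero
    tuples, with \<open>2 ^ k\<close> bounding the number of subsets D.\<close>
  define K where "K = \<bar>C1\<bar> * 2 powr c + 2 ^ k * C * 2 powr (1 + (c - b))"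
  have c: "0 < c" "c \<le> 1/2" "b < c" using r b by (auto simp: c_def)
  show ?thesis
  proof
    show "K \<ge> 0" using C by (simp add: K_def)
    fix p i :: nat and \<mu> :: "nat \<Rightarrow> nat" and a :: "nat \<Rightarrow> real"
    assume p: "prime p" and \<mu>: "\<mu> \<in> exponent_tuples k" "\<mu> \<noteq> zero_tuple k"
      and a: "\<And>j. j \<in> {1..k} \<Longrightarrow> a j \<le> -(r + 1) + (if j = i then b else 0)"
    have p2: "real p \<ge> 2" using prime_ge_2_nat[OF p] by simp
    define n where "n = (\<Sum>j=1..k. \<mu> j)"
    define W where "W = real p powr (\<Sum>j=1..k. a j * real (\<mu> j))"
    define E where "E = real p powr (-(1 + (c - b))) * (2 powr (-c)) ^ n"
    have n: "n \<noteq> 0" using zero_tuple_iff \<mu> by (auto simp: n_def)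
    have "norm (lcm_local_coeff r f k p \<mu>) * W \<le> K * E"
    proof (cases "n = 1")
      case True
      then obtain j where j: "j \<in> {1..k}" "\<mu> j = 1" "\<And>i. i \<in> {1..k} \<Longrightarrow> i \<noteq> j \<Longrightarrow> \<mu> i = 0"
        using sum_eq_1_iff[of "{1..k}" \<mu>] unfolding n_def by auto
      have supp: "{i\<in>{1..k}. \<mu> i \<ge> 1} = {j}" using j by force
      have img1: "(\<lambda>i\<in>{1..k}. \<mu> i - of_bool (i \<in> {})) ` {1..k} \<subseteq> {0,1}" "1 \<in> (\<lambda>i\<in>{1..k}. \<mu> i - of_bool (i \<in> {})) ` {1..k}"
        using j by force+
      have M1: "Max ((\<lambda>i\<in>{1..k}. \<mu> i - of_bool (i \<in> {})) ` {1..k}) = 1"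
        using img1 by (intro Max_eqI) auto
      have img2: "(\<lambda>i\<in>{1..k}. \<mu> i - of_bool (i \<in> {j})) ` {1..k} = {0}"
        using j k by force
      have Pow: "Pow {j} = {{}, {j}}" by auto
      have "lcm_local_coeff r f k p \<mu> = f p - of_real (real p powr r)"
        unfolding lcm_local_coeff_def local_coeff_def supp lcm_local_def Pow
        using M1 img2 f1 by simp
      moreover have "W \<le> real p powr (-(r + 1) + b)"
      proof -
        have "(\<Sum>j=1..k. a j * real (\<mu> j)) \<le> -(r + 1) * real n + b * real 1"
          unfolding n_def using j by (intro weight_exponent_le[where i = i] a b) force+
        thus ?thesis unfolding W_def using True p2 by (intro powr_mono) auto
      qed
      ultimately have "norm (lcm_local_coeff r f k p \<mu>) * W \<le> (\<bar>C1\<bar> * real p powr (r - 1/2)) * real p powr (-(r + 1) + b)"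
        using C1[OF p] mult_right_mono[OF abs_ge_self[of C1], of "real p powr (r - 1/2)"]
        by (intro mult_mono) (auto simp: W_def)
      also have "\<dots> = \<bar>C1\<bar> * real p powr (-(3/2 - b))"
        by (simp add: powr_add [symmetric] mult.assoc)
      \<comment> \<open>Here c \<le> 1/2 matches the saving of one half in the exponent of condition
        (i).\<close>
      also have "\<dots> \<le> \<bar>C1\<bar> * real p powr (-(1 + (c - b)))"
        using p2 c by (intro mult_left_mono powr_mono) auto
      \<comment> \<open>For n = 1 the factor \<open>E\<close> contains \<open>2 powr (-c)\<close>,
        which \<open>2 powr c\<close> cancels.\<close>
      also have "\<dots> = \<bar>C1\<bar> * 2 powr c * E"
        by (simp add: E_def True powr_minus)
      also have "\<dots> \<le> K * E" unfolding K_def E_def using C by (intro mult_right_mono) auto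
      finally show ?thesis .
    next
      case False
      have summand: "norm ((- of_real (real p powr r)) ^ card D * lcm_local f k p (\<lambda>i\<in>{1..k}. \<mu> i - of_bool (i \<in> D))) * W
          \<le> C * 2 powr (1 + (c - b)) * E" if D: "D \<subseteq> {i\<in>{1..k}. \<mu> i \<ge> 1}" for D
      proof -
        define \<rho> where "\<rho> = (\<lambda>i\<in>{1..k}. \<mu> i - of_bool (i \<in> D))"
        define L where "L = (\<Sum>i=1..k. \<rho> i)"
        define m where "m = Max (\<rho> ` {1..k})"
        define t where "t = card D"
        have "n = (\<Sum>i=1..k. \<rho> i + of_bool (i \<in> D))"
          unfolding n_def using D by (intro sum.cong) (auto simp: \<rho>_def)
        moreover have "(\<Sum>i=1..k. of_bool (i \<in> D)) = t"
          using D sum_of_bool_mem[of "{1..k}" D, where 'a = nat] unfolding t_def by fastforce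
        ultimately have n_eq: "n = t + L"
          by (simp only: sum.distrib L_def add.commute)
        have mL: "m \<le> L" "m = 0 \<Longrightarrow> L = 0"
          using Max_image_facts[OF k, where \<nu> = \<rho>] by (auto simp: m_def L_def)
        \<comment> \<open>Lowering by 1 happens only for j in D, and then D is nonempty, so t \<ge>
          1 makes up for it.\<close>
        have "\<mu> j \<le> t + m" if "j \<in> {1..k}" for j
        proof -
          have "finite D" using D by (rule finite_subset) auto
          hence "of_bool (j \<in> D) \<le> t" by (auto simp: t_def card_gt_0_iff Suc_le_eq)
          moreover have "\<rho> j \<le> m" using Max_image_facts(3)[OF k that] by (simp add: m_def)
          moreover have "\<mu> j \<le> \<rho> j + of_bool (j \<in> D)" using that by (auto simp: \<rho>_def)
          ultimately show ?thesis by linarith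
        qed
        hence w: "(\<Sum>j=1..k. a j * real (\<mu> j)) \<le> -(r + 1) * real n + b * real (t + m)"
          unfolding n_def by (intro weight_exponent_le[where i = i] a b)
        \<comment> \<open>The total exponent of p: \<open>r * t\<close> from the power of q,
          \<open>r * m\<close> from the bound for f at a prime power, and the weight.\<close>
        define X where "X = r * real t + r * real m + (\<Sum>j=1..k. a j * real (\<mu> j))"
        have X: "X \<le> -((1 - b) * (real t + real m) + (r + 1) * (real L - real m))"
          using w unfolding X_def n_eq by (simp add: algebra_simps)
        have X1: "X \<le> -(1 + (c - b))"
          using X exponent_bound(2)[OF mL b, of t] False n unfolding n_eq c_def by linarith
        have X2: "X \<le> -(c * real n)"
          using X exponent_bound(1)[OF mL b, of t] unfolding n_eq c_def of_nat_add by linarith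
        have "norm ((- of_real (real p powr r)) ^ card D * lcm_local f k p \<rho>) * W
            \<le> (real p powr r) ^ t * (C * real p powr (r * real m)) * W"
          unfolding norm_mult norm_power norm_minus_cancel norm_of_real lcm_local_def m_def [symmetric] t_def
          using C(2)[OF p, of m] by (intro mult_right_mono mult_mono) (auto simp: W_def)
        also have "\<dots> = C * real p powr X"
          using p2 by (simp add: X_def W_def powr_add powr_power mult.commute mult.left_commute)
        also have "\<dots> \<le> C * (2 powr (1 + (c - b)) * real p powr (-(1 + (c - b))) * (2 powr (-c)) ^ n)"
          using C p2 X1 X2 c by (intro mult_left_mono powr_le_powr_times_power) auto
        finally show ?thesis unfolding E_def \<rho>_def by (simp add: mult_ac)
      qed
      have "norm (lcm_local_coeff r f k p \<mu>) * W
          \<le> (\<Sum>D\<in>Pow {i\<in>{1..k}. \<mu> i \<ge> 1}. norm ((- of_real (real p powr r)) ^ card D *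
               lcm_local f k p (\<lambda>i\<in>{1..k}. \<mu> i - of_bool (i \<in> D)))) * W"
        unfolding lcm_local_coeff_def local_coeff_def by (intro mult_right_mono norm_sum) (auto simp: W_def)
      also have "\<dots> \<le> (\<Sum>D\<in>Pow {i\<in>{1..k}. \<mu> i \<ge> 1}. C * 2 powr (1 + (c - b)) * E)"
        unfolding sum_distrib_right using summand by (intro sum_mono) blast
      also have "\<dots> = 2 ^ card {i\<in>{1..k}. \<mu> i \<ge> 1} * (C * 2 powr (1 + (c - b)) * E)"
        by (simp add: card_Pow)
      also have "\<dots> \<le> 2 ^ k * (C * 2 powr (1 + (c - b)) * E)"
      proof -
        have "card {i\<in>{1..k}. \<mu> i \<ge> 1} \<le> card {1..k}" by (rule card_mono) auto
        thus ?thesis using C by (intro mult_right_mono power_increasing) (simp_all add: E_def)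
      qed
      also have "\<dots> \<le> K * E"
        using C by (simp add: K_def E_def algebra_simps)
      finally show ?thesis .
    qed
    thus "norm (lcm_local_coeff r f k p \<mu>) * real p powr (\<Sum>j=1..k. a j * real (\<mu> j))
         \<le> K * real p powr (-(1 + (c - b))) * (2 powr (-c)) ^ (\<Sum>j=1..k. \<mu> j)"
      by (simp add: W_def E_def n_def mult_ac)
  qed
qed

text \<open>The case t = 0, b = 0 of the exponent estimate gives
  \<open>r * m - (r+1) * L \<le> -(c * L)\<close> for the maximum m and the sum L of an exponent
  tuple, so a geometric series dominates.\<close>

lemma local_term_summable:
  assumes k: "k \<ge> 1" and r: "r > -1" and f: "f \<in> class_A r" and p: "prime p"
  shows "(\<lambda>\<nu>. norm (local_term r f k p \<nu>)) summable_on exponent_tuples k"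
proof -
  obtain C where C: "C \<ge> 0" "\<And>p m. prime p \<Longrightarrow> norm (f (p ^ m)) \<le> C * real p powr (r * real m)"
    using class_A_prime_power_bound[OF f] by blast
  define c where "c = min (r + 1) 1 / 2"
  have c: "0 < c" using r by (auto simp: c_def)
  have p2: "real p \<ge> 2" using prime_ge_2_nat[OF p] by simp
  have le: "norm (local_term r f k p \<nu>) \<le> C * (2 powr (-c)) ^ (\<Sum>i=1..k. \<nu> i)" for \<nu>
  proof -
    define L where "L = (\<Sum>i=1..k. \<nu> i)"
    define m where "m = Max (\<nu> ` {1..k})"
    have "norm (local_term r f k p \<nu>) = norm (f (p ^ m)) / real p powr ((r + 1) * real L)"
      unfolding local_term_def m_def L_def norm_divide norm_of_real by simp
    also have "\<dots> \<le> (C * real p powr (r * real m)) / real p powr ((r + 1) * real L)"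
      using C(2)[OF p] by (intro divide_right_mono) auto
    also have "\<dots> = C * real p powr (r * real m - (r + 1) * real L)"
      by (simp add: powr_diff)
    also have "\<dots> \<le> C * real p powr (-(c * real L))"
    proof (intro mult_left_mono powr_mono)
      show "r * real m - (r + 1) * real L \<le> -(c * real L)"
        using exponent_bound(1)[of m L 0 "r + 1" 0] Max_image_facts[OF k, where \<nu> = \<nu>] c
        unfolding m_def L_def c_def by (simp add: algebra_simps)
    qed (use C p2 in auto)
    also have "\<dots> \<le> C * 2 powr (-(c * real L))"
      using C p2 c by (intro mult_left_mono powr_mono2') auto
    also have "2 powr (-(c * real L)) = (2 powr (-c)) ^ L" by (simp add: powr_power mult.commute)
    finally show ?thesis unfolding L_def .
  qed
  have "2 powr (-c) < 1" using c powr_less_mono[of "-c" 0 2] by simp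
  hence "(\<lambda>\<nu>. C * (2 powr (-c)) ^ (\<Sum>i=1..k. \<nu> i)) summable_on exponent_tuples k"
    by (intro summable_on_cmult_right summable_power_exponent_tuples) auto
  thus ?thesis by (rule summable_on_comparison_test) (use le in auto)
qed

section \<open>Smooth tuples and prime factorisations\<close>

definition exponents :: "nat \<Rightarrow> nat \<Rightarrow> (nat \<Rightarrow> nat) \<Rightarrow> nat \<Rightarrow> nat" where
  "exponents k p n = (\<lambda>i\<in>{1..k}. multiplicity p (n i))"

definition smooth_tuples :: "nat \<Rightarrow> nat set \<Rightarrow> (nat \<Rightarrow> nat) set" where
  "smooth_tuples k P = {n\<in>pos_tuples k. \<forall>i\<in>{1..k}. prime_factors (n i) \<subseteq> P}"

lemma smooth_tuples_pos: "n \<in> smooth_tuples k P \<Longrightarrow> i \<in> {1..k} \<Longrightarrow> n i > 0"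
  using pos_tuplesD by (auto simp: smooth_tuples_def)

lemma smooth_tuple_eq_prod:
  assumes "finite P" "\<And>p. p \<in> P \<Longrightarrow> prime p" "n \<in> smooth_tuples k P" "i \<in> {1..k}"
  shows "n i = (\<Prod>p\<in>P. p ^ exponents k p n i)"
proof -
  have "n i = (\<Prod>p\<in>prime_factors (n i). p ^ multiplicity p (n i))"
    using smooth_tuples_pos[OF assms(3,4)] by (simp add: prod_prime_factors)
  also have "\<dots> = (\<Prod>p\<in>P. p ^ multiplicity p (n i))"
    using assms
    by (intro prod.mono_neutral_left) (auto simp: smooth_tuples_def prime_factors_multiplicity)
  finally show ?thesis using assms(4) by (simp add: exponents_def)
qed

text \<open>Unique factorisation in every coordinate, with the matrix of exponents read prime by
  prime. It turns a sum over smooth tuples into a sum over functions on P, the form in which a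
  product of sums over P expands.\<close>

lemma bij_betw_smooth_tuples:
  assumes P: "finite P" "\<And>p. p \<in> P \<Longrightarrow> prime p"
  shows "bij_betw (\<lambda>n. \<lambda>p\<in>P. exponents k p n) (smooth_tuples k P) (P \<rightarrow>\<^sub>E exponent_tuples k)"
proof (rule bij_betwI)
  let ?inv = "\<lambda>\<phi>. \<lambda>i\<in>{1..k}. \<Prod>p\<in>P. p ^ \<phi> p i"
  have mult: "multiplicity q (\<Prod>p\<in>P. p ^ \<phi> p i) = (if q \<in> P then \<phi> q i else 0)" if "prime q"
    for q i and \<phi> :: "nat \<Rightarrow> nat \<Rightarrow> nat"
    using multiplicity_prod_prime_powers[OF P that, of "\<lambda>p. \<phi> p i"] .
  have pos: "(\<Prod>p\<in>P. p ^ \<phi> p i) > 0" for i and \<phi> :: "nat \<Rightarrow> nat \<Rightarrow> nat"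
    using P(2) by (intro prod_pos) (auto simp: prime_gt_0_nat)
  show "(\<lambda>n. \<lambda>p\<in>P. exponents k p n) \<in> smooth_tuples k P \<rightarrow> P \<rightarrow>\<^sub>E exponent_tuples k"
    by (auto simp: exponents_def exponent_tuples_def)
  show "?inv \<in> (P \<rightarrow>\<^sub>E exponent_tuples k) \<rightarrow> smooth_tuples k P"
  proof
    fix \<phi> :: "nat \<Rightarrow> nat \<Rightarrow> nat"
    have "prime_factors (\<Prod>p\<in>P. p ^ \<phi> p i) \<subseteq> P" for i
      using mult by (auto simp: prime_factors_multiplicity split: if_splits)
    moreover have "?inv \<phi> \<in> pos_tuples k"
      using pos[of \<phi>] by (auto simp: pos_tuples_def Suc_le_eq)
    ultimately show "?inv \<phi> \<in> smooth_tuples k P"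
      by (auto simp: smooth_tuples_def)
  qed
  show "?inv (\<lambda>p\<in>P. exponents k p n) = n" if n: "n \<in> smooth_tuples k P" for n
  proof
    fix i
    show "?inv (\<lambda>p\<in>P. exponents k p n) i = n i"
    proof (cases "i \<in> {1..k}")
      case True
      thus ?thesis using smooth_tuple_eq_prod[OF P n True] by simp
    next
      case False
      thus ?thesis using n by (auto simp: smooth_tuples_def pos_tuples_def PiE_iff extensional_def)
    qed
  qed
  show "(\<lambda>p\<in>P. exponents k p (?inv \<phi>)) = \<phi>" if "\<phi> \<in> P \<rightarrow>\<^sub>E exponent_tuples k" for \<phi>
  proof
    fix p
    show "(\<lambda>p\<in>P. exponents k p (?inv \<phi>)) p = \<phi> p"
    proof (cases "p \<in> P")
      case True
      hence "exponents k p (?inv \<phi>) = (\<lambda>i\<in>{1..k}. \<phi> p i)"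
        unfolding exponents_def using mult[OF P(2)[OF True]] by (auto simp: fun_eq_iff)
      also have "\<dots> = \<phi> p"
        using that True by (auto simp: exponent_tuples_def PiE_iff extensional_def fun_eq_iff)
      finally show ?thesis using True by simp
    next
      case False
      thus ?thesis using that by (auto simp: PiE_iff extensional_def)
    qed
  qed
qed

lemma smooth_tuple_dvd_iff:
  assumes "finite P" "\<And>p. p \<in> P \<Longrightarrow> prime p" "e \<in> smooth_tuples k P" "n \<in> smooth_tuples k P"
  shows "tuple_dvd k e n \<longleftrightarrow> (\<forall>p\<in>P. \<forall>i\<in>{1..k}. exponents k p e i \<le> exponents k p n i)"
proof
  assume "tuple_dvd k e n"
  thus "\<forall>p\<in>P. \<forall>i\<in>{1..k}. exponents k p e i \<le> exponents k p n i"
    using smooth_tuples_pos[OF assms(4)] by (auto simp: tuple_dvd_def exponents_def intro!: dvd_imp_multiplicity_le)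
next
  assume *: "\<forall>p\<in>P. \<forall>i\<in>{1..k}. exponents k p e i \<le> exponents k p n i"
  have "e i dvd n i" if i: "i \<in> {1..k}" for i
  proof -
    have "e i = (\<Prod>p\<in>P. p ^ exponents k p e i)" "n i = (\<Prod>p\<in>P. p ^ exponents k p n i)"
      using assms i by (auto intro: smooth_tuple_eq_prod)
    thus ?thesis using * i by (auto intro!: prod_dvd_prod le_imp_power_dvd)
  qed
  thus "tuple_dvd k e n" by (simp add: tuple_dvd_def)
qed

lemma tuple_dvd_smooth:
  assumes "e \<in> pos_tuples k" "n \<in> smooth_tuples k P" "tuple_dvd k e n"
  shows "e \<in> smooth_tuples k P"
proof -
  have "prime_factors (e i) \<subseteq> P" if i: "i \<in> {1..k}" for i
    using assms i dvd_prime_factors[of "n i" "e i"] smooth_tuples_pos[OF assms(2) i]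
    by (fastforce simp: smooth_tuples_def tuple_dvd_def)
  thus ?thesis using assms(1) by (auto simp: smooth_tuples_def)
qed

lemma multiplicative_arith_prod_prime_powers:
  assumes f: "multiplicative_arith f" and P: "finite P" "\<And>p. p \<in> P \<Longrightarrow> prime p"
  shows "f (\<Prod>p\<in>P. p ^ m p) = (\<Prod>p\<in>P. f (p ^ m p))"
  using P
proof (induction P rule: finite_induct)
  case empty
  thus ?case using f by (simp add: multiplicative_arith_def)
next
  case (insert p P)
  have "coprime (p ^ m p) (\<Prod>q\<in>P. q ^ m q)"
  proof (rule prod_coprime_right)
    fix q assume q: "q \<in> P"
    hence "coprime p q" using insert.prems insert.hyps by (intro primes_coprime) auto
    thus "coprime (p ^ m p) (q ^ m q)" by simp
  qed
  moreover have "p ^ m p > 0" "(\<Prod>q\<in>P. q ^ m q) > 0"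
    using insert.prems by (auto simp: prime_gt_0_nat intro!: prod_pos)
  ultimately have "f (p ^ m p * (\<Prod>q\<in>P. q ^ m q)) = f (p ^ m p) * f (\<Prod>q\<in>P. q ^ m q)"
    using f unfolding multiplicative_arith_def by blast
  thus ?case using insert by simp
qed

lemma tuple_lcm_smooth:
  assumes k: "k \<ge> 1" and P: "finite P" "\<And>p. p \<in> P \<Longrightarrow> prime p" and n: "n \<in> smooth_tuples k P"
  shows "tuple_lcm k n = (\<Prod>p\<in>P. p ^ Max (exponents k p n ` {1..k}))"
proof (rule dvd_antisym)
  show "tuple_lcm k n dvd (\<Prod>p\<in>P. p ^ Max (exponents k p n ` {1..k}))"
    unfolding tuple_lcm_def
  proof (rule Lcm_least)
    fix a assume "a \<in> n ` {1..k}"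
    then obtain i where i: "i \<in> {1..k}" "a = n i" by auto
    have "a = (\<Prod>p\<in>P. p ^ exponents k p n i)"
      unfolding i(2) by (rule smooth_tuple_eq_prod[OF P n i(1)])
    also have "\<dots> dvd (\<Prod>p\<in>P. p ^ Max (exponents k p n ` {1..k}))"
      using i by (intro prod_dvd_prod le_imp_power_dvd Max_ge) auto
    finally show "a dvd (\<Prod>p\<in>P. p ^ Max (exponents k p n ` {1..k}))" .
  qed
next
  show "(\<Prod>p\<in>P. p ^ Max (exponents k p n ` {1..k})) dvd tuple_lcm k n"
  proof (rule multiplicity_le_imp_dvd)
    show "(\<Prod>p\<in>P. p ^ Max (exponents k p n ` {1..k})) \<noteq> 0"
      using P prime_gt_0_nat by auto
    fix p :: nat assume p: "prime p"
    show "multiplicity p (\<Prod>p\<in>P. p ^ Max (exponents k p n ` {1..k})) \<le> multiplicity p (tuple_lcm k n)"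
    proof (cases "p \<in> P")
      case True
      have "Max (exponents k p n ` {1..k}) \<in> exponents k p n ` {1..k}" using k by (intro Max_in) auto
      then obtain i where i: "i \<in> {1..k}" "Max (exponents k p n ` {1..k}) = multiplicity p (n i)"
        by (auto simp: exponents_def)
      have "0 \<notin> n ` {1..k}" using smooth_tuples_pos[OF n] by force
      hence "tuple_lcm k n \<noteq> 0" by (simp add: tuple_lcm_def Lcm_0_iff)
      moreover have "n i dvd tuple_lcm k n" unfolding tuple_lcm_def using i by (intro dvd_Lcm) auto
      ultimately have "multiplicity p (n i) \<le> multiplicity p (tuple_lcm k n)"
        by (intro dvd_imp_multiplicity_le)
      thus ?thesis using multiplicity_prod_prime_powers[OF P p] True i by simp
    next
      case False
      thus ?thesis using multiplicity_prod_prime_powers[OF P p] by simp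
    qed
  qed
qed

text \<open>The function h of the overview. The product runs over the primes of the entries of e, so
  that the value depends on no auxiliary set of primes.\<close>

definition lcm_coeff :: "real \<Rightarrow> (nat \<Rightarrow> complex) \<Rightarrow> nat \<Rightarrow> (nat \<Rightarrow> nat) \<Rightarrow> complex" where
  "lcm_coeff r f k e = (\<Prod>p\<in>prime_factors (\<Prod>i=1..k. e i). lcm_local_coeff r f k p (exponents k p e))"

lemma lcm_local_coeff_zero_tuple:
  assumes "multiplicative_arith f" "k \<ge> 1"
  shows "lcm_local_coeff r f k p (zero_tuple k) = 1"
proof -
  have "zero_tuple k ` {1..k} = {0}" using assms(2) by (force simp: zero_tuple_def)
  thus ?thesis
    using assms(1) by (simp add: lcm_local_coeff_def local_coeff_zero_tuple lcm_local_def multiplicative_arith_def)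
qed

text \<open>A prime of P dividing no entry of e sees the zero tuple, where the local coefficient is
  \<open>f 1 = 1\<close>. Hence one common P may be used for many e.\<close>

lemma lcm_coeff_smooth:
  assumes f: "multiplicative_arith f" and k: "k \<ge> 1"
    and P: "finite P" "\<And>p. p \<in> P \<Longrightarrow> prime p" and e: "e \<in> smooth_tuples k P"
  shows "lcm_coeff r f k e = (\<Prod>p\<in>P. lcm_local_coeff r f k p (exponents k p e))"
  unfolding lcm_coeff_def
proof (rule prod.mono_neutral_left)
  have e0: "(\<Prod>i=1..k. e i) \<noteq> 0" using smooth_tuples_pos[OF e] by auto
  show "prime_factors (\<Prod>i=1..k. e i) \<subseteq> P"
  proof
    fix p assume "p \<in> prime_factors (\<Prod>i=1..k. e i)"
    hence "prime p" "p dvd (\<Prod>i=1..k. e i)" by auto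
    then obtain i where "i \<in> {1..k}" "p dvd e i" by (auto simp: prime_dvd_prod_iff)
    hence "p \<in> prime_factors (e i)" using smooth_tuples_pos[OF e] \<open>prime p\<close> by (auto simp: prime_factors_dvd)
    thus "p \<in> P" using e \<open>i \<in> {1..k}\<close> by (auto simp: smooth_tuples_def)
  qed
  show "\<forall>p\<in>P - prime_factors (\<Prod>i=1..k. e i). lcm_local_coeff r f k p (exponents k p e) = 1"
  proof
    fix p assume p: "p \<in> P - prime_factors (\<Prod>i=1..k. e i)"
    have "\<not> p dvd e i" if i: "i \<in> {1..k}" for i
    proof
      assume "p dvd e i"
      also have "e i dvd (\<Prod>i=1..k. e i)" using i by (intro dvd_prodI) auto
      finally show False using p P(2) e0 by (auto simp: prime_factors_dvd)
    qed
    hence "exponents k p e = zero_tuple k"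
      by (auto simp: exponents_def zero_tuple_def fun_eq_iff not_dvd_imp_multiplicity_0)
    thus "lcm_local_coeff r f k p (exponents k p e) = 1"
      using lcm_local_coeff_zero_tuple[OF f k] by simp
  qed
qed (use P in auto)

lemma pos_tuples_smooth:
  assumes "n \<in> pos_tuples k"
  shows "n \<in> smooth_tuples k (prime_factors (\<Prod>i=1..k. n i))"
proof -
  have "(\<Prod>i=1..k. n i) \<noteq> 0" using pos_tuplesD[OF assms] by auto
  moreover have "n i dvd (\<Prod>i=1..k. n i)" if "i \<in> {1..k}" for i using that by (intro dvd_prodI) auto
  ultimately have "prime_factors (n i) \<subseteq> prime_factors (\<Prod>i=1..k. n i)" if "i \<in> {1..k}" for i
    using that by (intro dvd_prime_factors)
  thus ?thesis using assms by (auto simp: smooth_tuples_def)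
qed

lemma weight_smooth:
  assumes P: "finite P" "\<And>p. p \<in> P \<Longrightarrow> prime p" and e: "e \<in> smooth_tuples k P"
  shows "(\<Prod>j=1..k. real (e j) powr a j) = (\<Prod>p\<in>P. real p powr (\<Sum>j=1..k. a j * real (exponents k p e j)))"
proof -
  have "(\<Prod>j=1..k. real (e j) powr a j) = (\<Prod>j=1..k. \<Prod>p\<in>P. real p powr (a j * real (exponents k p e j)))"
  proof (rule prod.cong[OF refl])
    fix j assume j: "j \<in> {1..k}"
    have "real (e j) = (\<Prod>p\<in>P. real p ^ exponents k p e j)"
      using arg_cong[OF smooth_tuple_eq_prod[OF P e j], of real] by simp
    hence "real (e j) powr a j = (\<Prod>p\<in>P. (real p ^ exponents k p e j) powr a j)"
      by (simp add: prod_powr_distrib)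
    also have "\<dots> = (\<Prod>p\<in>P. real p powr (a j * real (exponents k p e j)))"
      using P(2) prime_gt_0_nat by (intro prod.cong) (auto simp: powr_realpow [symmetric] powr_powr mult.commute)
    finally show "real (e j) powr a j = (\<Prod>p\<in>P. real p powr (a j * real (exponents k p e j)))" .
  qed
  also have "\<dots> = (\<Prod>p\<in>P. \<Prod>j=1..k. real p powr (a j * real (exponents k p e j)))"
    by (rule prod.swap)
  also have "\<dots> = (\<Prod>p\<in>P. real p powr (\<Sum>j=1..k. a j * real (exponents k p e j)))"
    using P(2) prime_gt_0_nat by (intro prod.cong refl) (subst powr_sum, auto)
  finally show ?thesis .
qed

text \<open>The local inversion is applied at each prime dividing some entry of n. Expanding the
  product of the local sums means choosing at each prime an exponent tuple below that of n, and such
  choices are exactly the tuples e dividing n.\<close>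

lemma lcm_convolution:
  assumes f: "multiplicative_arith f" and k: "k \<ge> 1" and n: "n \<in> pos_tuples k"
  shows "f (tuple_lcm k n) = (\<Sum>e | e \<in> pos_tuples k \<and> tuple_dvd k e n.
    lcm_coeff r f k e * (\<Prod>i=1..k. of_real ((real (n i) / real (e i)) powr r)))"
proof -
  define P where "P = prime_factors (\<Prod>i=1..k. n i)"
  have P: "finite P" "\<And>p. p \<in> P \<Longrightarrow> prime p" by (auto simp: P_def)
  have nP: "n \<in> smooth_tuples k P" unfolding P_def by (rule pos_tuples_smooth[OF n])
  define B where "B = (\<lambda>p. PiE {1..k} (\<lambda>i. {..exponents k p n i}))"
  define g where "g = (\<lambda>p \<mu>. lcm_local_coeff r f k p \<mu> *
      of_real (real p powr r) ^ (\<Sum>i=1..k. exponents k p n i - \<mu> i))"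
  have "f (tuple_lcm k n) = f (\<Prod>p\<in>P. p ^ Max (exponents k p n ` {1..k}))"
    by (intro arg_cong[of _ _ f] tuple_lcm_smooth[OF k P nP])
  also have "\<dots> = (\<Prod>p\<in>P. lcm_local f k p (exponents k p n))"
    unfolding lcm_local_def by (rule multiplicative_arith_prod_prime_powers[OF f P])
  also have "\<dots> = (\<Prod>p\<in>P. \<Sum>\<mu>\<in>B p. g p \<mu>)"
    unfolding g_def B_def lcm_local_coeff_def
    by (intro prod.cong refl local_coeff_inversion [symmetric]) (auto simp: exponents_def exponent_tuples_def)
  also have "\<dots> = (\<Sum>\<phi>\<in>PiE P B. \<Prod>p\<in>P. g p (\<phi> p))"
    using P by (intro prod_sum_PiE) (auto simp: B_def intro!: finite_PiE)
  also have "\<dots> = (\<Sum>e | e \<in> smooth_tuples k P \<and> tuple_dvd k e n. \<Prod>p\<in>P. g p ((\<lambda>p\<in>P. exponents k p e) p))"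
  proof (rule sum.reindex_bij_betw [symmetric])
    have "(\<lambda>e. \<lambda>p\<in>P. exponents k p e) ` {e. e \<in> smooth_tuples k P \<and> tuple_dvd k e n} = PiE P B"
    proof (intro equalityI subsetI)
      fix \<phi> assume "\<phi> \<in> (\<lambda>e. \<lambda>p\<in>P. exponents k p e) ` {e. e \<in> smooth_tuples k P \<and> tuple_dvd k e n}"
      thus "\<phi> \<in> PiE P B"
        using smooth_tuple_dvd_iff[OF P _ nP] by (auto simp: B_def PiE_iff exponents_def)
    next
      fix \<phi> assume \<phi>: "\<phi> \<in> PiE P B"
      hence "\<phi> \<in> P \<rightarrow>\<^sub>E exponent_tuples k" by (auto simp: B_def exponent_tuples_def PiE_iff)
      hence "\<phi> \<in> (\<lambda>e. \<lambda>p\<in>P. exponents k p e) ` smooth_tuples k P"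
        using bij_betw_imp_surj_on[OF bij_betw_smooth_tuples[OF P, of k]] by simp
      then obtain e where e: "e \<in> smooth_tuples k P" "\<phi> = (\<lambda>p\<in>P. exponents k p e)" by blast
      have "tuple_dvd k e n"
        using \<phi> smooth_tuple_dvd_iff[OF P e(1) nP] unfolding e(2) by (auto simp: B_def PiE_iff)
      thus "\<phi> \<in> (\<lambda>e. \<lambda>p\<in>P. exponents k p e) ` {e. e \<in> smooth_tuples k P \<and> tuple_dvd k e n}"
        using e by blast
    qed
    thus "bij_betw (\<lambda>e. \<lambda>p\<in>P. exponents k p e) {e. e \<in> smooth_tuples k P \<and> tuple_dvd k e n} (PiE P B)"
      by (intro bij_betw_subset[OF bij_betw_smooth_tuples[OF P, of k]]) auto
  qed
  also have "\<dots> = (\<Sum>e | e \<in> smooth_tuples k P \<and> tuple_dvd k e n.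
      lcm_coeff r f k e * (\<Prod>i=1..k. of_real ((real (n i) / real (e i)) powr r)))"
  proof (rule sum.cong[OF refl])
    fix e assume "e \<in> {e. e \<in> smooth_tuples k P \<and> tuple_dvd k e n}"
    hence e: "e \<in> smooth_tuples k P" "tuple_dvd k e n" by auto
    have le: "exponents k p e i \<le> exponents k p n i" if "p \<in> P" "i \<in> {1..k}" for p i
      using smooth_tuple_dvd_iff[OF P e(1) nP] e(2) that by blast
    have "(\<Prod>i=1..k. (real (n i) / real (e i)) powr r)
        = (\<Prod>p\<in>P. real p powr (\<Sum>j=1..k. r * real (exponents k p n j))) /
          (\<Prod>p\<in>P. real p powr (\<Sum>j=1..k. r * real (exponents k p e j)))"
      unfolding powr_divide prod_dividef
      using weight_smooth[OF P e(1), of "\<lambda>_. r"] weight_smooth[OF P nP, of "\<lambda>_. r"] by simp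
    also have "\<dots> = (\<Prod>p\<in>P. real p powr (r * real (\<Sum>i=1..k. exponents k p n i - exponents k p e i)))"
      using le by (simp add: prod_dividef [symmetric] powr_diff [symmetric] sum_subtractf sum_distrib_left
          right_diff_distrib of_nat_diff)
    also have "\<dots> = (\<Prod>p\<in>P. (real p powr r) ^ (\<Sum>i=1..k. exponents k p n i - exponents k p e i))"
      using P(2) prime_gt_0_nat by (intro prod.cong refl) (simp add: powr_power mult.commute)
    finally have w: "(\<Prod>i=1..k. (real (n i) / real (e i)) powr r)
        = (\<Prod>p\<in>P. (real p powr r) ^ (\<Sum>i=1..k. exponents k p n i - exponents k p e i))" .
    show "(\<Prod>p\<in>P. g p ((\<lambda>p\<in>P. exponents k p e) p)) =
        lcm_coeff r f k e * (\<Prod>i=1..k. of_real ((real (n i) / real (e i)) powr r))"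
      unfolding of_real_prod [symmetric] w
      by (simp add: g_def prod.distrib lcm_coeff_smooth[OF f k P e(1)])
  qed
  also have "{e. e \<in> smooth_tuples k P \<and> tuple_dvd k e n} = {e. e \<in> pos_tuples k \<and> tuple_dvd k e n}"
    using tuple_dvd_smooth[OF _ nP] by (auto simp: smooth_tuples_def)
  finally show ?thesis .
qed

section \<open>Absolute convergence and the Euler product\<close>

lemma has_sum_of_bool_eq:
  assumes "a \<in> A"
  shows "((\<lambda>x. of_bool (x = a) :: 'b::{topological_comm_monoid_add,semiring_1}) has_sum 1) A"
proof -
  have "((\<lambda>x. of_bool (x = a) :: 'b) has_sum 1) {a}" by (rule has_sum_finiteI) auto
  also have "?this \<longleftrightarrow> ?thesis" using assms by (intro has_sum_cong_neutral) auto
  finally show ?thesis .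
qed

text \<open>The zero tuple contributes exactly 1, and the other tuples together at most K U
  p^(-1-(c-b)), where U is the sum of the geometric majorant. The constants do not depend on p or on
  the weights \<open>a\<close>. The upper bound on the norms serves absolute summability, the
  distance from 1 the convergence of the Euler product.\<close>

lemma lcm_local_sums:
  assumes k: "k \<ge> 1" and r: "r > -1" and f: "f \<in> class_A r" and b: "0 \<le> b" "b < min (r + 1) 1 / 2"
  obtains L \<eta> where "L \<ge> 0" "\<eta> > 0"
    "\<And>p a i. prime p \<Longrightarrow> (\<And>j. j \<in> {1..k} \<Longrightarrow> a j \<le> -(r + 1) + (if j = i then b else 0)) \<Longrightarrow>
       (\<lambda>\<mu>. norm (lcm_local_coeff r f k p \<mu>) * real p powr (\<Sum>j=1..k. a j * real (\<mu> j))) summable_on exponent_tuples k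
     \<and> (\<Sum>\<^sub>\<infinity>\<mu>\<in>exponent_tuples k. norm (lcm_local_coeff r f k p \<mu>) * real p powr (\<Sum>j=1..k. a j * real (\<mu> j)))
         \<le> 1 + L * real p powr (-(1 + \<eta>))
     \<and> norm ((\<Sum>\<^sub>\<infinity>\<mu>\<in>exponent_tuples k. lcm_local_coeff r f k p \<mu> * of_real (real p powr (\<Sum>j=1..k. a j * real (\<mu> j)))) - 1)
         \<le> L * real p powr (-(1 + \<eta>))"
proof -
  define c where "c = min (r + 1) 1 / 2"
  obtain K where K: "K \<ge> 0"
    "\<And>p \<mu> a i. prime p \<Longrightarrow> \<mu> \<in> exponent_tuples k \<Longrightarrow> \<mu> \<noteq> zero_tuple k \<Longrightarrow>
       (\<And>j. j \<in> {1..k} \<Longrightarrow> a j \<le> -(r + 1) + (if j = i then b else 0)) \<Longrightarrow>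
       norm (lcm_local_coeff r f k p \<mu>) * real p powr (\<Sum>j=1..k. a j * real (\<mu> j))
         \<le> K * real p powr (-(1 + (c - b))) * (2 powr (-c)) ^ (\<Sum>j=1..k. \<mu> j)"
    using lcm_local_coeff_bound[OF k r f b] unfolding c_def by blast
  have c: "c > 0" "c - b > 0" using r b by (auto simp: c_def)
  define u :: real where "u = 2 powr (-c)"
  have u: "0 \<le> u" "u < 1" using c powr_less_mono[of "-c" 0 2] by (auto simp: u_def)
  define U where "U = (\<Sum>\<^sub>\<infinity>\<mu>\<in>exponent_tuples k. u ^ (\<Sum>j=1..k. \<mu> j))"
  have U: "((\<lambda>\<mu>. u ^ (\<Sum>j=1..k. \<mu> j)) has_sum U) (exponent_tuples k)"
    unfolding U_def using summable_power_exponent_tuples[OF u] by (rule has_sum_infsum)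
  have U0: "U \<ge> 0" unfolding U_def using u by (intro infsum_nonneg) auto
  have mf: "multiplicative_arith f" using f by (simp add: class_A_def)
  have "(\<lambda>\<mu>. norm (lcm_local_coeff r f k p \<mu>) * real p powr (\<Sum>j=1..k. a j * real (\<mu> j))) summable_on exponent_tuples k
     \<and> (\<Sum>\<^sub>\<infinity>\<mu>\<in>exponent_tuples k. norm (lcm_local_coeff r f k p \<mu>) * real p powr (\<Sum>j=1..k. a j * real (\<mu> j)))
         \<le> 1 + K * U * real p powr (-(1 + (c - b)))
     \<and> norm ((\<Sum>\<^sub>\<infinity>\<mu>\<in>exponent_tuples k. lcm_local_coeff r f k p \<mu> * of_real (real p powr (\<Sum>j=1..k. a j * real (\<mu> j)))) - 1)
         \<le> K * U * real p powr (-(1 + (c - b)))"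
    if p: "prime p" and a: "\<And>j. j \<in> {1..k} \<Longrightarrow> a j \<le> -(r + 1) + (if j = i then b else 0)"
    for p i :: nat and a :: "nat \<Rightarrow> real"
  proof -
    define h where "h = lcm_local_coeff r f k p"
    define W where "W = (\<lambda>\<mu>::nat \<Rightarrow> nat. real p powr (\<Sum>j=1..k. a j * real (\<mu> j)))"
    define v where "v = (\<lambda>\<mu>. K * real p powr (-(1 + (c - b))) * u ^ (\<Sum>j=1..k. \<mu> j))"
    have W_nonneg: "W \<mu> \<ge> 0" for \<mu> by (simp add: W_def)
    have W0: "W (zero_tuple k) = 1" using prime_gt_0_nat[OF p] by (simp add: W_def zero_tuple_def)
    have h0: "h (zero_tuple k) = 1" unfolding h_def by (rule lcm_local_coeff_zero_tuple[OF mf k])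
    have v0: "v \<mu> \<ge> 0" for \<mu> using K(1) u by (simp add: v_def)
    have v: "(v has_sum K * U * real p powr (-(1 + (c - b)))) (exponent_tuples k)"
      using has_sum_cmult_right[OF U, of "K * real p powr (-(1 + (c - b)))"]
      unfolding v_def by (simp add: mult_ac)
    have hv: "norm (h \<mu>) * W \<mu> \<le> v \<mu>" if "\<mu> \<in> exponent_tuples k" "\<mu> \<noteq> zero_tuple k" for \<mu>
      using K(2)[OF p that a] unfolding h_def W_def v_def u_def .
    have one: "((\<lambda>\<mu>. of_bool (\<mu> = zero_tuple k) :: real) has_sum 1) (exponent_tuples k)"
      "((\<lambda>\<mu>. of_bool (\<mu> = zero_tuple k) :: complex) has_sum 1) (exponent_tuples k)"
      by (rule has_sum_of_bool_eq[OF zero_tuple_in])+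
    have le: "norm (h \<mu>) * W \<mu> \<le> of_bool (\<mu> = zero_tuple k) + v \<mu>" if "\<mu> \<in> exponent_tuples k" for \<mu>
      using hv[OF that] v0[of \<mu>] by (cases "\<mu> = zero_tuple k") (auto simp: W0 h0)
    have S: "(\<lambda>\<mu>. norm (h \<mu>) * W \<mu>) summable_on exponent_tuples k"
      using has_sum_imp_summable[OF has_sum_add[OF one(1) v]]
      by (rule summable_on_comparison_test) (use le in \<open>auto simp: W_def\<close>)
    moreover have "(\<Sum>\<^sub>\<infinity>\<mu>\<in>exponent_tuples k. norm (h \<mu>) * W \<mu>) \<le> 1 + K * U * real p powr (-(1 + (c - b)))"
      using le by (rule has_sum_mono[OF has_sum_infsum[OF S] has_sum_add[OF one(1) v]])
    moreover have "norm ((\<Sum>\<^sub>\<infinity>\<mu>\<in>exponent_tuples k. h \<mu> * of_real (W \<mu>)) - 1) \<le> K * U * real p powr (-(1 + (c - b)))"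
    proof (rule norm_infsum_le)
      have "(\<lambda>\<mu>. h \<mu> * of_real (W \<mu>)) summable_on exponent_tuples k"
        using S by (rule abs_summable_summable[OF summable_on_cong[THEN iffD1, rotated]]) (simp add: norm_mult W_def)
      moreover have "((\<lambda>\<mu>. - of_bool (\<mu> = zero_tuple k) :: complex) has_sum - 1) (exponent_tuples k)"
        using one(2) by (simp add: has_sum_uminus)
      ultimately show "((\<lambda>\<mu>. h \<mu> * of_real (W \<mu>) + - of_bool (\<mu> = zero_tuple k)) has_sum
          ((\<Sum>\<^sub>\<infinity>\<mu>\<in>exponent_tuples k. h \<mu> * of_real (W \<mu>)) - 1)) (exponent_tuples k)"
        unfolding diff_conv_add_uminus by (intro has_sum_add has_sum_infsum)
      show "norm (h \<mu> * of_real (W \<mu>) + - of_bool (\<mu> = zero_tuple k)) \<le> v \<mu>" if "\<mu> \<in> exponent_tuples k" for \<mu>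
        using hv[OF that] v0[of \<mu>]
        by (cases "\<mu> = zero_tuple k") (auto simp: W0 h0 norm_mult W_nonneg)
    qed (rule v)
    ultimately show ?thesis unfolding h_def W_def by blast
  qed
  moreover have "K * U \<ge> 0" using K(1) U0 by simp
  ultimately show ?thesis using that c(2) by blast
qed

lemma infsum_smooth_tuples:
  fixes g :: "nat \<Rightarrow> (nat \<Rightarrow> nat) \<Rightarrow> complex"
  assumes P: "finite P" "\<And>p. p \<in> P \<Longrightarrow> prime p"
    and g: "\<And>p. p \<in> P \<Longrightarrow> (\<lambda>\<mu>. norm (g p \<mu>)) summable_on exponent_tuples k"
  shows "(\<Sum>\<^sub>\<infinity>e\<in>smooth_tuples k P. \<Prod>p\<in>P. g p (exponents k p e)) = (\<Prod>p\<in>P. \<Sum>\<^sub>\<infinity>\<mu>\<in>exponent_tuples k. g p \<mu>)"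
proof -
  have "(\<Sum>\<^sub>\<infinity>e\<in>smooth_tuples k P. \<Prod>p\<in>P. g p (exponents k p e))
      = (\<Sum>\<^sub>\<infinity>e\<in>smooth_tuples k P. (\<lambda>\<phi>. \<Prod>p\<in>P. g p (\<phi> p)) (\<lambda>p\<in>P. exponents k p e))"
    by simp
  also have "\<dots> = (\<Sum>\<^sub>\<infinity>\<phi>\<in>P \<rightarrow>\<^sub>E exponent_tuples k. \<Prod>p\<in>P. g p (\<phi> p))"
    by (rule infsum_reindex_bij_betw[OF bij_betw_smooth_tuples[OF P]])
  also have "\<dots> = (\<Prod>p\<in>P. \<Sum>\<^sub>\<infinity>\<mu>\<in>exponent_tuples k. g p \<mu>)"
    using P(1) g by (rule infsum_prod_PiE_abs)
  finally show ?thesis .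
qed

text \<open>Stated for finite F because it is used to bound partial sums, from which summability
  over all tuples is deduced.\<close>

lemma sum_smooth_tuples_le:
  fixes g :: "nat \<Rightarrow> (nat \<Rightarrow> nat) \<Rightarrow> real"
  assumes P: "finite P" "\<And>p. p \<in> P \<Longrightarrow> prime p" and F: "finite F" "F \<subseteq> smooth_tuples k P"
    and g: "\<And>p \<mu>. p \<in> P \<Longrightarrow> g p \<mu> \<ge> 0" "\<And>p. p \<in> P \<Longrightarrow> g p summable_on exponent_tuples k"
  shows "(\<Sum>e\<in>F. \<Prod>p\<in>P. g p (exponents k p e)) \<le> (\<Prod>p\<in>P. \<Sum>\<^sub>\<infinity>\<mu>\<in>exponent_tuples k. g p \<mu>)"
proof -
  let ?E = "\<lambda>n. \<lambda>p\<in>P. exponents k p n"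
  have bij: "bij_betw ?E (smooth_tuples k P) (P \<rightarrow>\<^sub>E exponent_tuples k)"
    by (rule bij_betw_smooth_tuples[OF P])
  have inj: "inj_on ?E F" using bij F(2) by (auto simp: bij_betw_def intro: inj_on_subset)
  have "(\<Sum>e\<in>F. \<Prod>p\<in>P. g p (exponents k p e)) = (\<Sum>e\<in>F. \<Prod>p\<in>P. g p (?E e p))" by simp
  also have "\<dots> = (\<Sum>\<phi>\<in>?E ` F. \<Prod>p\<in>P. g p (\<phi> p))"
    by (subst sum.reindex[OF inj]) (simp add: o_def)
  also have "\<dots> \<le> (\<Prod>p\<in>P. \<Sum>\<^sub>\<infinity>\<mu>\<in>exponent_tuples k. g p \<mu>)"
  proof (rule prod_sum_PiE_le)
    show "?E ` F \<subseteq> P \<rightarrow>\<^sub>E exponent_tuples k" using F(2) bij by (auto simp: bij_betw_def)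
  qed (use P F g in auto)
  finally show ?thesis .
qed

section \<open>Passage from finitely many primes to all primes\<close>

definition primes_upto :: "nat \<Rightarrow> nat set" where
  "primes_upto N = {p. prime p \<and> p \<le> N}"

lemma primes_upto: "finite (primes_upto N)" "\<And>p. p \<in> primes_upto N \<Longrightarrow> prime p"
  by (auto simp: primes_upto_def)

lemma finite_subset_smooth_tuples:
  assumes "finite F" "F \<subseteq> pos_tuples k"
  obtains N where "\<And>M. M \<ge> N \<Longrightarrow> F \<subseteq> smooth_tuples k (primes_upto M)"
proof -
  define N where "N = Max (insert 0 (\<Union>e\<in>F. e ` {1..k}))"
  have "F \<subseteq> smooth_tuples k (primes_upto M)" if M: "M \<ge> N" for M
  proof
    fix e assume e: "e \<in> F"
    have "prime_factors (e i) \<subseteq> primes_upto M" if i: "i \<in> {1..k}" for i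
    proof
      fix p assume p: "p \<in> prime_factors (e i)"
      hence "p \<le> e i" using pos_tuplesD[of e k i] assms(2) e i by (auto intro!: dvd_imp_le)
      also have "e i \<in> insert 0 (\<Union>e\<in>F. e ` {1..k})" using e i by blast
      hence "e i \<le> N" unfolding N_def using assms(1) by (intro Max_ge) auto
      finally show "p \<in> primes_upto M" using p M by (auto simp: primes_upto_def)
    qed
    thus "e \<in> smooth_tuples k (primes_upto M)" using e assms(2) by (auto simp: smooth_tuples_def)
  qed
  thus ?thesis using that by blast
qed

text \<open>Every finite partial sum lies below a finite Euler product with factors 1 + L
  p^(-1-\<eta>), hence below \<open>exp (L * Z)\<close>, where Z sums n^(-1-\<eta>) over all n and
  thus does not depend on the set of primes.\<close>

lemma lcm_coeff_weight_summable:
  assumes k: "k \<ge> 1" and r: "r > -1" and f: "f \<in> class_A r" and b: "0 \<le> b" "b < min (r + 1) 1 / 2"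
    and a: "\<And>j. j \<in> {1..k} \<Longrightarrow> a j \<le> -(r + 1) + (if j = i then b else 0)"
  shows "(\<lambda>e. norm (lcm_coeff r f k e) * (\<Prod>j=1..k. real (e j) powr a j)) summable_on pos_tuples k"
proof -
  define g where "g = (\<lambda>p \<mu>. norm (lcm_local_coeff r f k p \<mu>) * real p powr (\<Sum>j=1..k. a j * real (\<mu> j)))"
  obtain L \<eta> where L: "L \<ge> 0" "\<eta> > 0"
    "\<And>p. prime p \<Longrightarrow> g p summable_on exponent_tuples k \<and>
        (\<Sum>\<^sub>\<infinity>\<mu>\<in>exponent_tuples k. g p \<mu>) \<le> 1 + L * real p powr (-(1 + \<eta>))"
  proof -
    obtain L \<eta> where "L \<ge> 0" "\<eta> > 0" and
      *: "\<And>p a i. prime p \<Longrightarrow> (\<And>j. j \<in> {1..k} \<Longrightarrow> a j \<le> -(r + 1) + (if j = i then b else 0)) \<Longrightarrow>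
       (\<lambda>\<mu>. norm (lcm_local_coeff r f k p \<mu>) * real p powr (\<Sum>j=1..k. a j * real (\<mu> j))) summable_on exponent_tuples k
     \<and> (\<Sum>\<^sub>\<infinity>\<mu>\<in>exponent_tuples k. norm (lcm_local_coeff r f k p \<mu>) * real p powr (\<Sum>j=1..k. a j * real (\<mu> j)))
         \<le> 1 + L * real p powr (-(1 + \<eta>))
     \<and> norm ((\<Sum>\<^sub>\<infinity>\<mu>\<in>exponent_tuples k. lcm_local_coeff r f k p \<mu> * of_real (real p powr (\<Sum>j=1..k. a j * real (\<mu> j)))) - 1)
         \<le> L * real p powr (-(1 + \<eta>))"
      using lcm_local_sums[OF k r f b] by blast
    show ?thesis
      using that[of L \<eta>] *[OF _ a] \<open>L \<ge> 0\<close> \<open>\<eta> > 0\<close> unfolding g_def by simp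
  qed
  have mf: "multiplicative_arith f" using f by (simp add: class_A_def)
  have sm: "summable (\<lambda>n. real n powr (-(1 + \<eta>)))"
    using L(2) by (subst summable_real_powr_iff) auto
  define Z where "Z = (\<Sum>n. real n powr (-(1 + \<eta>)))"
  show ?thesis
  proof (rule nonneg_bdd_above_summable_on)
    show "bdd_above (sum (\<lambda>e. norm (lcm_coeff r f k e) * (\<Prod>j=1..k. real (e j) powr a j)) ` {F. F \<subseteq> pos_tuples k \<and> finite F})"
    proof (rule bdd_aboveI2)
      fix F assume "F \<in> {F. F \<subseteq> pos_tuples k \<and> finite F}"
      hence F: "finite F" "F \<subseteq> pos_tuples k" by auto
      then obtain N where N: "F \<subseteq> smooth_tuples k (primes_upto N)"
        using finite_subset_smooth_tuples[OF F] by (metis order_refl)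
      define P where "P = primes_upto N"
      have P: "finite P" "\<And>p. p \<in> P \<Longrightarrow> prime p" unfolding P_def using primes_upto by auto
      have "(\<Sum>e\<in>F. norm (lcm_coeff r f k e) * (\<Prod>j=1..k. real (e j) powr a j))
          = (\<Sum>e\<in>F. \<Prod>p\<in>P. g p (exponents k p e))"
      proof (rule sum.cong[OF refl])
        fix e assume "e \<in> F"
        hence e: "e \<in> smooth_tuples k P" using N by (auto simp: P_def)
        show "norm (lcm_coeff r f k e) * (\<Prod>j=1..k. real (e j) powr a j) = (\<Prod>p\<in>P. g p (exponents k p e))"
          using lcm_coeff_smooth[OF mf k P e, where r = r] weight_smooth[OF P e, where a = a]
          by (simp add: g_def prod.distrib prod_norm)
      qed
      also have "\<dots> \<le> (\<Prod>p\<in>P. \<Sum>\<^sub>\<infinity>\<mu>\<in>exponent_tuples k. g p \<mu>)"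
        by (rule sum_smooth_tuples_le) (use P F N L in \<open>auto simp: P_def g_def\<close>)
      also have "\<dots> \<le> (\<Prod>p\<in>P. exp (L * real p powr (-(1 + \<eta>))))"
      proof (intro prod_mono conjI)
        fix p assume "p \<in> P"
        hence "prime p" using P by blast
        show "(\<Sum>\<^sub>\<infinity>\<mu>\<in>exponent_tuples k. g p \<mu>) \<ge> 0" by (intro infsum_nonneg) (auto simp: g_def)
        have "(\<Sum>\<^sub>\<infinity>\<mu>\<in>exponent_tuples k. g p \<mu>) \<le> 1 + L * real p powr (-(1 + \<eta>))" using L \<open>prime p\<close> by blast
        also have "\<dots> \<le> exp (L * real p powr (-(1 + \<eta>)))" by (rule exp_ge_add_one_self)
        finally show "(\<Sum>\<^sub>\<infinity>\<mu>\<in>exponent_tuples k. g p \<mu>) \<le> exp (L * real p powr (-(1 + \<eta>)))" .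
      qed
      also have "\<dots> = exp (L * (\<Sum>p\<in>P. real p powr (-(1 + \<eta>))))"
        using P by (simp add: exp_sum sum_distrib_left)
      also have "\<dots> \<le> exp (L * Z)"
        unfolding exp_le_cancel_iff Z_def using L P sm by (intro mult_left_mono sum_le_suminf) auto
      finally show "(\<Sum>e\<in>F. norm (lcm_coeff r f k e) * (\<Prod>j=1..k. real (e j) powr a j)) \<le> exp (L * Z)" .
    qed
  qed (auto intro!: mult_nonneg_nonneg prod_nonneg)
qed

text \<open>With q = \<open>p powr r\<close> and z = \<open>p powr (-(r+1))\<close> the product q z
  is 1/p, so the factor \<open>(1 - q * z) ^ k\<close> of the local identity is the
  \<open>(1 - 1/p) ^ k\<close> in the constant.\<close>

lemma euler_factor_eq:
  assumes k: "k \<ge> 1" and r: "r > -1" and f: "f \<in> class_A r" and p: "prime p"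
  shows "euler_factor r f k p = (\<Sum>\<^sub>\<infinity>\<mu>\<in>exponent_tuples k. lcm_local_coeff r f k p \<mu> *
           of_real (real p powr (\<Sum>j=1..k. -(r + 1) * real (\<mu> j))))"
proof -
  have p0: "real p > 0" using prime_gt_0_nat[OF p] by simp
  define z where "z = (of_real (real p powr (-(r + 1))) :: complex)"
  have z: "z ^ n = of_real (real p powr (-(r + 1) * real n))" for n
    unfolding z_def using p0 by (simp only: powr_power of_real_power [symmetric]) (simp add: mult.commute)
  define A where "A = (\<Sum>\<^sub>\<infinity>\<nu>\<in>exponent_tuples k. local_term r f k p \<nu>)"
  have "(local_term r f k p has_sum A) (exponent_tuples k)"
    unfolding A_def using local_term_summable[OF k r f p] by (intro has_sum_infsum) (rule abs_summable_summable)
  also have "local_term r f k p = (\<lambda>\<nu>. lcm_local f k p \<nu> * z ^ (\<Sum>i=1..k. \<nu> i))"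
    unfolding local_term_def lcm_local_def z
    by (intro ext) (simp only: mult_minus_left powr_minus of_real_inverse divide_inverse)
  finally have "((\<lambda>\<mu>. lcm_local_coeff r f k p \<mu> * z ^ (\<Sum>i=1..k. \<mu> i)) has_sum
      (1 - of_real (real p powr r) * z) ^ k * A) (exponent_tuples k)"
    unfolding lcm_local_coeff_def by (rule local_coeff_has_sum)
  moreover have "of_real (real p powr r) * z = 1 / of_nat p"
  proof -
    have "real p powr r * real p powr (-(r + 1)) = 1 / real p"
      using p0 by (simp add: powr_add [symmetric] powr_minus_divide)
    hence "of_real (real p powr r * real p powr (-(r + 1))) = (of_real (1 / real p) :: complex)" by (rule arg_cong)
    thus ?thesis by (simp add: z_def)
  qed
  moreover have "z ^ (\<Sum>i=1..k. \<mu> i) = of_real (real p powr (\<Sum>j=1..k. -(r + 1) * real (\<mu> j)))" for \<mu>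
    unfolding z by (simp add: sum_distrib_left)
  ultimately show ?thesis
    using p by (simp add: euler_factor_def infsumI A_def)
qed

text \<open>A finite F carries all but \<epsilon>/2 of the absolute sum; once \<open>B n\<close>
  contains F, what \<open>B n\<close> misses lies in the complement of F.\<close>

lemma infsum_tendsto_exhaustion:
  fixes g :: "'a \<Rightarrow> 'b::banach"
  assumes g: "(\<lambda>x. norm (g x)) summable_on A" and B: "\<And>n. B n \<subseteq> A"
    and ex: "\<And>F. finite F \<Longrightarrow> F \<subseteq> A \<Longrightarrow> \<exists>N. \<forall>n\<ge>N. F \<subseteq> B n"
  shows "(\<lambda>n. infsum g (B n)) \<longlonglongrightarrow> infsum g A"
proof (rule LIMSEQ_I)
  fix \<epsilon> :: real assume \<epsilon>: "\<epsilon> > 0"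
  obtain F where F: "finite F" "F \<subseteq> A" "dist (\<Sum>x\<in>F. norm (g x)) (\<Sum>\<^sub>\<infinity>x\<in>A. norm (g x)) \<le> \<epsilon> / 2"
    using infsum_finite_approximation[OF g, of "\<epsilon> / 2"] \<epsilon> by auto
  obtain N where N: "\<And>n. n \<ge> N \<Longrightarrow> F \<subseteq> B n" using ex[OF F(1,2)] by blast
  have "norm (infsum g (B n) - infsum g A) < \<epsilon>" if n: "n \<ge> N" for n
  proof -
    have sub: "(\<lambda>x. norm (g x)) summable_on C" if "C \<subseteq> A" for C
      using g that by (rule summable_on_subset)
    have "infsum g A = infsum g (B n \<union> (A - B n))" using B[of n] by (simp add: Un_absorb1)
    also have "\<dots> = infsum g (B n) + infsum g (A - B n)"
      using sub B[of n] by (intro infsum_Un_disjoint abs_summable_summable[OF sub]) auto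
    finally have "norm (infsum g (B n) - infsum g A) = norm (infsum g (A - B n))" by simp
    also have "\<dots> \<le> (\<Sum>\<^sub>\<infinity>x\<in>A - B n. norm (g x))"
      using sub by (intro norm_infsum_bound) auto
    also have "\<dots> \<le> (\<Sum>\<^sub>\<infinity>x\<in>A - F. norm (g x))"
      using sub N[OF n] by (intro infsum_mono2) auto
    also have "\<dots> = (\<Sum>\<^sub>\<infinity>x\<in>A. norm (g x)) - (\<Sum>x\<in>F. norm (g x))"
      using infsum_Diff[OF g, of F] F by simp
    also have "\<dots> < \<epsilon>" using F(3) \<epsilon> unfolding dist_real_def by linarith
    finally show ?thesis .
  qed
  thus "\<exists>N. \<forall>n\<ge>N. norm (infsum g (B n) - infsum g A) < \<epsilon>" by blast
qed

text \<open>The partial product up to N equals the sum over tuples whose primes are at most N. As N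
  grows it tends to the infinite product on one side and, by absolute convergence, to the full sum
  on the other.\<close>

lemma lcm_const_eq:
  assumes k: "k \<ge> 1" and r: "r > -1" and f: "f \<in> class_A r"
  shows "convergent_prod (euler_factor r f k)"
    and "lcm_const r f k = (\<Sum>\<^sub>\<infinity>e\<in>pos_tuples k. lcm_coeff r f k e * of_real (\<Prod>j=1..k. real (e j) powr (-(r + 1))))"
proof -
  define g where "g = (\<lambda>p \<mu>. lcm_local_coeff r f k p \<mu> * complex_of_real (real p powr (\<Sum>j=1..k. -(r + 1) * real (\<mu> j))))"
  have b: "0 \<le> (0::real)" "0 < min (r + 1) 1 / 2" using r by auto
  have mf: "multiplicative_arith f" using f by (simp add: class_A_def)
  obtain L \<eta> where L: "L \<ge> 0" "\<eta> > 0"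
    "\<And>p a i. prime p \<Longrightarrow> (\<And>j. j \<in> {1..k} \<Longrightarrow> a j \<le> -(r + 1) + (if j = i then 0 else 0)) \<Longrightarrow>
       (\<lambda>\<mu>. norm (lcm_local_coeff r f k p \<mu>) * real p powr (\<Sum>j=1..k. a j * real (\<mu> j))) summable_on exponent_tuples k
     \<and> (\<Sum>\<^sub>\<infinity>\<mu>\<in>exponent_tuples k. norm (lcm_local_coeff r f k p \<mu>) * real p powr (\<Sum>j=1..k. a j * real (\<mu> j)))
         \<le> 1 + L * real p powr (-(1 + \<eta>))
     \<and> norm ((\<Sum>\<^sub>\<infinity>\<mu>\<in>exponent_tuples k. lcm_local_coeff r f k p \<mu> * of_real (real p powr (\<Sum>j=1..k. a j * real (\<mu> j)))) - 1)
         \<le> L * real p powr (-(1 + \<eta>))"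
    using lcm_local_sums[OF k r f b] by blast
  have gs: "(\<lambda>\<mu>. norm (g p \<mu>)) summable_on exponent_tuples k"
    and g1: "norm (euler_factor r f k p - 1) \<le> L * real p powr (-(1 + \<eta>))" if p: "prime p" for p
    using L(3)[OF p, of "\<lambda>_. -(r + 1)"] euler_factor_eq[OF k r f p] by (auto simp: g_def norm_mult)
  have "summable (\<lambda>p. norm (euler_factor r f k p - 1))"
  proof (rule summable_comparison_test')
    show "summable (\<lambda>n. L * real n powr (-(1 + \<eta>)))"
      using L(2) by (intro summable_mult) (subst summable_real_powr_iff, auto)
    show "norm (norm (euler_factor r f k p - 1)) \<le> L * real p powr (-(1 + \<eta>))" if "p \<ge> 0" for p
      using g1[of p] L(1) by (cases "prime p") (auto simp: euler_factor_def)
  qed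
  \<comment> \<open>Single factors may vanish: \<open>convergent_prod\<close> tolerates finitely
    many zeros, and the partial products still tend to \<open>prodinf\<close>.\<close>
  thus conv: "convergent_prod (euler_factor r f k)"
    by (intro abs_convergent_prod_imp_convergent_prod summable_imp_abs_convergent_prod)
  define G where "G = (\<lambda>e. lcm_coeff r f k e * complex_of_real (\<Prod>j=1..k. real (e j) powr (-(r + 1))))"
  have "(\<lambda>N. \<Prod>p\<le>N. euler_factor r f k p) \<longlonglongrightarrow> lcm_const r f k"
    unfolding lcm_const_def by (rule convergent_prod_LIMSEQ[OF conv])
  also have "(\<lambda>N. \<Prod>p\<le>N. euler_factor r f k p) = (\<lambda>N. infsum G (smooth_tuples k (primes_upto N)))"
  proof
    fix N
    have P: "finite (primes_upto N)" "\<And>p. p \<in> primes_upto N \<Longrightarrow> prime p" using primes_upto by auto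
    have "infsum G (smooth_tuples k (primes_upto N))
        = (\<Sum>\<^sub>\<infinity>e\<in>smooth_tuples k (primes_upto N). \<Prod>p\<in>primes_upto N. g p (exponents k p e))"
    proof (rule infsum_cong)
      fix e assume e: "e \<in> smooth_tuples k (primes_upto N)"
      show "G e = (\<Prod>p\<in>primes_upto N. g p (exponents k p e))"
        unfolding G_def g_def prod.distrib of_real_prod [symmetric]
        using lcm_coeff_smooth[OF mf k P e, where r = r] weight_smooth[OF P e, where a = "\<lambda>_. -(r + 1)"]
        by simp
    qed
    also have "\<dots> = (\<Prod>p\<in>primes_upto N. euler_factor r f k p)"
    proof -
      have "(\<Sum>\<^sub>\<infinity>e\<in>smooth_tuples k (primes_upto N). \<Prod>p\<in>primes_upto N. g p (exponents k p e))
          = (\<Prod>p\<in>primes_upto N. \<Sum>\<^sub>\<infinity>\<mu>\<in>exponent_tuples k. g p \<mu>)"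
        by (rule infsum_smooth_tuples[OF P gs[OF P(2)]])
      also have "\<dots> = (\<Prod>p\<in>primes_upto N. euler_factor r f k p)"
        unfolding g_def by (rule prod.cong[OF refl], rule euler_factor_eq[OF k r f P(2), symmetric])
      finally show ?thesis .
    qed
    also have "\<dots> = (\<Prod>p\<le>N. euler_factor r f k p)"
      by (intro prod.mono_neutral_left) (auto simp: primes_upto_def euler_factor_def)
    finally show "(\<Prod>p\<le>N. euler_factor r f k p) = infsum G (smooth_tuples k (primes_upto N))" ..
  qed
  finally have "(\<lambda>N. infsum G (smooth_tuples k (primes_upto N))) \<longlonglongrightarrow> lcm_const r f k" .
  moreover have "(\<lambda>N. infsum G (smooth_tuples k (primes_upto N))) \<longlonglongrightarrow> infsum G (pos_tuples k)"
  proof (rule infsum_tendsto_exhaustion)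
    have "(\<lambda>e. norm (lcm_coeff r f k e) * (\<Prod>j=1..k. real (e j) powr (-(r + 1)))) summable_on pos_tuples k"
      by (rule lcm_coeff_weight_summable[OF k r f b, where i = 0]) auto
    thus "(\<lambda>e. norm (G e)) summable_on pos_tuples k"
      by (simp add: G_def norm_mult abs_prod del: of_real_prod)
    show "smooth_tuples k (primes_upto N) \<subseteq> pos_tuples k" for N by (auto simp: smooth_tuples_def)
    show "\<exists>N. \<forall>n\<ge>N. F \<subseteq> smooth_tuples k (primes_upto n)" if "finite F" "F \<subseteq> pos_tuples k" for F
      using finite_subset_smooth_tuples[OF that] by (metis (no_types))
  qed
  ultimately show "lcm_const r f k = (\<Sum>\<^sub>\<infinity>e\<in>pos_tuples k. lcm_coeff r f k e * of_real (\<Prod>j=1..k. real (e j) powr (-(r + 1))))"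
    unfolding G_def by (rule LIMSEQ_unique)
qed

section \<open>The asymptotic formulas\<close>

text \<open>The last condition on s says c \<le> min s 1, so that every b < c is admissible in the
  estimate of the power sums. It holds for both s = r + 1 and s = 1.\<close>

lemma lcm_sum_asymptotics:
  assumes k: "k \<ge> 1" and r: "r > -1" and f: "f \<in> class_A r" and \<epsilon>: "\<epsilon> > 0"
    and s: "s = r + 1 - q" "s > 0" "min (r + 1) 1 \<le> 2 * min s 1"
  shows "(\<lambda>x::real. (\<Sum>n\<in>pos_tuples_upto k x. f (tuple_lcm k n) / of_real (real (\<Prod>i=1..k. n i) powr q))
            - lcm_const r f k * of_real (x powr (real k * s) / s ^ k))
         \<in> O[at_top](\<lambda>x. of_real (x powr (real k * s - 1/2 * min (r + 1) 1 + \<epsilon>)))"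
proof -
  define c where "c = min (r + 1) 1 / 2"
  \<comment> \<open>Stays strictly below c at a cost of at most \<epsilon> in the exponent; the
    maximum with 0 covers \<epsilon> > c.\<close>
  define b where "b = max 0 (c - \<epsilon>)"
  have c: "c > 0" using r by (auto simp: c_def)
  have "c \<le> min s 1" "0 < min s 1" using s(2,3) by (auto simp: c_def)
  hence b: "0 \<le> b" "b < c" "b \<le> min s 1" "b \<ge> c - \<epsilon>"
    using c \<epsilon> unfolding b_def by linarith+
  hence b2: "b < min (r + 1) 1 / 2" by (simp only: c_def)
  have mf: "multiplicative_arith f" using f by (simp add: class_A_def)
  have "\<exists>K. \<forall>x\<ge>1.
    norm ((\<Sum>n\<in>pos_tuples_upto k x. f (tuple_lcm k n) / of_real (real (\<Prod>i=1..k. n i) powr q))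
      - (\<Sum>\<^sub>\<infinity>e\<in>pos_tuples k. lcm_coeff r f k e * of_real (\<Prod>j=1..k. real (e j) powr (-(r + 1))))
        * of_real (x powr (real k * s) / s ^ k)) \<le> K * x powr (real k * s - b)"
  proof (rule sum_convolution_asymptotics[where F = "\<lambda>n. f (tuple_lcm k n)" and h = "lcm_coeff r f k" and r = r and q = q and s = s and b = b])
    show "f (tuple_lcm k n) = (\<Sum>e | e \<in> pos_tuples k \<and> tuple_dvd k e n.
        lcm_coeff r f k e * (\<Prod>i=1..k. of_real ((real (n i) / real (e i)) powr r)))" if "n \<in> pos_tuples k" for n
      by (rule lcm_convolution[OF mf k that])
    show "(\<lambda>e. norm (lcm_coeff r f k e) * (\<Prod>j=1..k. real (e j) powr (-(r + 1)))) summable_on pos_tuples k"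
      by (rule lcm_coeff_weight_summable[OF k r f b(1) b2, where i = 0]) auto
    show "(\<lambda>e. norm (lcm_coeff r f k e) * (\<Prod>j=1..k. real (e j) powr (-(r + 1) + (if j = i then b else 0))))
        summable_on pos_tuples k" for i
      by (rule lcm_coeff_weight_summable[OF k r f b(1) b2, where i = i]) auto
  qed (fact s b)+
  then obtain K where K: "\<And>x. x \<ge> 1 \<Longrightarrow>
    norm ((\<Sum>n\<in>pos_tuples_upto k x. f (tuple_lcm k n) / of_real (real (\<Prod>i=1..k. n i) powr q))
      - (\<Sum>\<^sub>\<infinity>e\<in>pos_tuples k. lcm_coeff r f k e * of_real (\<Prod>j=1..k. real (e j) powr (-(r + 1))))
        * of_real (x powr (real k * s) / s ^ k)) \<le> K * x powr (real k * s - b)"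
    by blast
  show ?thesis
  proof (rule bigoI[where c = "\<bar>K\<bar>"])
    show "\<forall>\<^sub>F x in at_top. norm ((\<Sum>n\<in>pos_tuples_upto k x. f (tuple_lcm k n) / of_real (real (\<Prod>i=1..k. n i) powr q))
            - lcm_const r f k * of_real (x powr (real k * s) / s ^ k))
        \<le> \<bar>K\<bar> * norm (of_real (x powr (real k * s - 1/2 * min (r + 1) 1 + \<epsilon>)) :: complex)"
      using eventually_ge_at_top[of 1]
    proof eventually_elim
      case (elim x)
      have "norm ((\<Sum>n\<in>pos_tuples_upto k x. f (tuple_lcm k n) / of_real (real (\<Prod>i=1..k. n i) powr q))
            - lcm_const r f k * of_real (x powr (real k * s) / s ^ k)) \<le> K * x powr (real k * s - b)"
        unfolding lcm_const_eq(2)[OF k r f] by (rule K[OF elim])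
      also have "\<dots> \<le> \<bar>K\<bar> * x powr (real k * s - 1/2 * min (r + 1) 1 + \<epsilon>)"
        using b(4) elim by (intro mult_mono powr_mono) (auto simp: c_def)
      finally show ?case by simp
    qed
  qed
qed

theorem theorem2p1:
  fixes k :: nat and r \<epsilon> :: real and f :: "nat \<Rightarrow> complex"
  assumes "k \<ge> 2" and "r > -1" and "f \<in> class_A r" and "\<epsilon> > 0"
  shows "(\<forall>p. prime p \<longrightarrow> local_term r f k p summable_on exponent_tuples k)
    \<and> convergent_prod (euler_factor r f k)
    \<and> (\<lambda>x::real. (\<Sum>n\<in>pos_tuples_upto k x. f (tuple_lcm k n))
            - lcm_const r f k * of_real (x powr (real k * (r + 1)) / (r + 1) ^ k))
         \<in> O[at_top](\<lambda>x. of_real (x powr (real k * (r + 1) - 1/2 * min (r + 1) 1 + \<epsilon>)))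
    \<and> (\<lambda>x::real. (\<Sum>n\<in>pos_tuples_upto k x.
              f (tuple_lcm k n) / of_real (real (\<Prod>i=1..k. n i) powr r))
            - lcm_const r f k * of_real (x ^ k))
         \<in> O[at_top](\<lambda>x. of_real (x powr (real k - 1/2 * min (r + 1) 1 + \<epsilon>)))"
proof (intro conjI allI impI)
  have k: "k \<ge> 1" using assms(1) by simp
  show "local_term r f k p summable_on exponent_tuples k" if "prime p" for p
    using local_term_summable[OF k assms(2,3) that] by (rule abs_summable_summable)
  show "convergent_prod (euler_factor r f k)" by (rule lcm_const_eq(1)[OF k assms(2,3)])
  \<comment> \<open>The first sum is the case q = 0. As \<open>0 powr 0 = 0\<close>, the denominator
    is 1 only because the entries are positive.\<close>
  have "(\<Sum>n\<in>pos_tuples_upto k x. f (tuple_lcm k n) / of_real (real (\<Prod>i=1..k. n i) powr 0))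
      = (\<Sum>n\<in>pos_tuples_upto k x. f (tuple_lcm k n))" for x
  proof (rule sum.cong[OF refl])
    fix n assume "n \<in> pos_tuples_upto k x"
    hence "(\<Prod>i=1..k. n i) > 0" using pos_tuples_upto_subset[of k x] by (intro prod_pos pos_tuplesD) auto
    hence "real (\<Prod>i=1..k. n i) powr 0 = 1" by (simp only: powr_zero_eq_one of_nat_eq_0_iff) simp
    thus "f (tuple_lcm k n) / of_real (real (\<Prod>i=1..k. n i) powr 0) = f (tuple_lcm k n)" by (simp only:) simp
  qed
  thus "(\<lambda>x::real. (\<Sum>n\<in>pos_tuples_upto k x. f (tuple_lcm k n))
            - lcm_const r f k * of_real (x powr (real k * (r + 1)) / (r + 1) ^ k))
         \<in> O[at_top](\<lambda>x. of_real (x powr (real k * (r + 1) - 1/2 * min (r + 1) 1 + \<epsilon>)))"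
    using lcm_sum_asymptotics[OF k assms(2-4), of "r + 1" 0] assms(2) by simp
  \<comment> \<open>The second sum is the case q = r, s = 1; afterwards \<open>x powr k\<close> is
    replaced by \<open>x ^ k\<close>, which agrees with it for x > 0.\<close>
  have "(\<lambda>x::real. (\<Sum>n\<in>pos_tuples_upto k x.
              f (tuple_lcm k n) / of_real (real (\<Prod>i=1..k. n i) powr r))
            - lcm_const r f k * of_real (x powr (real k * 1) / 1 ^ k))
         \<in> O[at_top](\<lambda>x. of_real (x powr (real k * 1 - 1/2 * min (r + 1) 1 + \<epsilon>)))"
    using assms(2) by (intro lcm_sum_asymptotics[OF k assms(2-4)]) auto
  also have "?this \<longleftrightarrow> (\<lambda>x::real. (\<Sum>n\<in>pos_tuples_upto k x.
              f (tuple_lcm k n) / of_real (real (\<Prod>i=1..k. n i) powr r))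
            - lcm_const r f k * of_real (x ^ k))
         \<in> O[at_top](\<lambda>x. of_real (x powr (real k - 1/2 * min (r + 1) 1 + \<epsilon>)))"
    unfolding mult_1_right
  proof (rule landau_o.big.in_cong)
    show "\<forall>\<^sub>F x in at_top. (\<Sum>n\<in>pos_tuples_upto k x.
              f (tuple_lcm k n) / of_real (real (\<Prod>i=1..k. n i) powr r))
            - lcm_const r f k * of_real (x powr real k / 1 ^ k) = (\<Sum>n\<in>pos_tuples_upto k x.
              f (tuple_lcm k n) / of_real (real (\<Prod>i=1..k. n i) powr r))
            - lcm_const r f k * of_real (x ^ k)"
      using eventually_gt_at_top[of 0] by eventually_elim (simp add: powr_realpow)
  qed
  finally show "(\<lambda>x::real. (\<Sum>n\<in>pos_tuples_upto k x.
              f (tuple_lcm k n) / of_real (real (\<Prod>i=1..k. n i) powr r))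
            - lcm_const r f k * of_real (x ^ k))
         \<in> O[at_top](\<lambda>x. of_real (x powr (real k - 1/2 * min (r + 1) 1 + \<epsilon>)))" .
qed

end
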